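(* Let $\mathcal{O}$ be an oriented matroid of rank $r$ with ground set $E$ and let $f\in E$. Let $I=[e_1,\dots,e_k]$, $k\le r$, be an ordered set of independent elements of $E$. Let $l\le k$ be the smallest index with $f\in\mathrm{cl}(\{e_1,\dots,e_l\})$, and $l=k+1$ if there is no such index. Assume (i) $(\mathcal{O},e_1,f),(\mathcal{O}/\{e_1\},e_2,f),\dots,(\mathcal{O}/\{e_1,\dots,e_{l-2}\},e_{l-1},f)$ are Euclidean oriented matroid programs, and (ii) if $f$ is not in general position or $f\in I$, then $(\mathcal{O}/\{e_1,\dots,e_{i-1}\},e_i,e_j)$ is a Euclidean oriented matroid program for all $1\le i\le\min(l,k-1)$ and $i<j\le k$. Let $\mathcal{O}'=\mathcal{O}\cup p$ be the lexicographic extension $\mathcal{O}[e_1^+,\dots,e_k^+]$. Then $(\mathcal{O}',p,f)$ is a Euclidean oriented matroid program.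
   Context: Oriented matroids are given by covectors in $\{+,-,0\}^E$; cocircuits are minimal nonzero covectors; $z(X)=\{e:X_e=0\}$, $\mathrm{sep}(X,Y)=\{e:X_e=-Y_e\ne0\}$, conformal means $\mathrm{sep}=\emptyset$. For rank $r$, cocircuits $X\ne\pm Y$ are comodular if $z(X\circ Y)$ is a flat of rank $r-2$; elimination of $e\in\mathrm{sep}(X,Y)$ then yields the unique cocircuit $Z$ with $Z_e=0$, $\mathrm{supp}(Z)\subseteq\mathrm{supp}(X\circ Y)\setminus\{e\}$. An oriented matroid program $(\mathcal{O},g,f)$: distinct $g,f$, $g$ not a loop, $f$ not a coloop. For comodular cocircuits $X,Y$ with $X_g=Y_g\ne0$ and $Z$ the elimination of $g$ between $-X$ and $Y$: $X\to Y$, $X\leftarrow Y$, or undirected according as $Z_f=+,-,0$. $G_f$: vertices the cocircuits with $g=+$, edges the conformal comodular pairs, directed so. The program is Euclidean if $G_f$ has no directed cycle (closed sequence of distinct vertices along edges each forward or undirected, at least one forward). $f$ is in general position if $f\notin\mathrm{cl}(S)$ for all $S\subseteq E\setminus\{f\}$ of rank $<r$. $\mathcal{O}[e_1^+,\dots,e_k^+]=\mathcal{O}\cup p$ is the single-element extension by $p$ with localization $\sigma(Y)=Y_{e_i}$ for cocircuits $Y$, $i$ the least index with $Y_{e_i}\ne0$, $\sigma(Y)=0$ if none. *)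

theory Defs
  imports Main
begin

section \<open>Sign vectors\<close>

datatype sign = Zero | Pos | Neg

instantiation sign :: uminus
begin

primrec uminus_sign :: "sign \<Rightarrow> sign" where
  "- Zero = Zero"
| "- Pos = Neg"
| "- Neg = Pos"

instance ..

end

text \<open>A sign vector on a ground set \<open>E\<close> is a total function that is \<^term>\<open>Zero\<close> outside \<open>E\<close>.
  Negation \<open>- X\<close> is the library's pointwise negation on functions.\<close>

type_synonym 'a sign_vector = "'a \<Rightarrow> sign"

definition supp :: "'a sign_vector \<Rightarrow> 'a set" where
  "supp X = {e. X e \<noteq> Zero}"

definition sep :: "'a sign_vector \<Rightarrow> 'a sign_vector \<Rightarrow> 'a set" where
  "sep X Y = {e. X e = - Y e \<and> X e \<noteq> Zero}"

definition conformal :: "'a sign_vector \<Rightarrow> 'a sign_vector \<Rightarrow> bool" where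
  "conformal X Y \<longleftrightarrow> sep X Y = {}"

definition compose :: "'a sign_vector \<Rightarrow> 'a sign_vector \<Rightarrow> 'a sign_vector" where
  "compose X Y = (\<lambda>e. if X e \<noteq> Zero then X e else Y e)"

text \<open>The product order on sign vectors induced by \<open>0 < +\<close> and \<open>0 < -\<close>.\<close>

definition sv_le :: "'a sign_vector \<Rightarrow> 'a sign_vector \<Rightarrow> bool" where
  "sv_le X Y \<longleftrightarrow> (\<forall>e. X e = Zero \<or> X e = Y e)"


section \<open>Oriented matroids given by covectors\<close>

record 'a om =
  ground :: "'a set"
  covectors :: "'a sign_vector set"

definition oriented_matroid :: "'a om \<Rightarrow> bool" where
  "oriented_matroid M \<longleftrightarrow>
     finite (ground M) \<and>
     (\<forall>X\<in>covectors M. supp X \<subseteq> ground M) \<and>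
     (\<lambda>_. Zero) \<in> covectors M \<and>
     (\<forall>X\<in>covectors M. - X \<in> covectors M) \<and>
     (\<forall>X\<in>covectors M. \<forall>Y\<in>covectors M. compose X Y \<in> covectors M) \<and>
     (\<forall>X\<in>covectors M. \<forall>Y\<in>covectors M. \<forall>e\<in>sep X Y.
        \<exists>Z\<in>covectors M. Z e = Zero \<and> (\<forall>h. h \<notin> sep X Y \<longrightarrow> Z h = compose X Y h))"

definition cocircuits :: "'a om \<Rightarrow> 'a sign_vector set" where
  "cocircuits M =
     {X \<in> covectors M. X \<noteq> (\<lambda>_. Zero) \<and>
        (\<forall>Y\<in>covectors M. Y \<noteq> (\<lambda>_. Zero) \<and> sv_le Y X \<longrightarrow> Y = X)}"

definition zero_set :: "'a om \<Rightarrow> 'a sign_vector \<Rightarrow> 'a set" where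
  "zero_set M X = {e \<in> ground M. X e = Zero}"


subsection \<open>The underlying matroid\<close>

text \<open>The flats of the underlying matroid are exactly the zero sets of the covectors; the other
  matroid notions are derived from the flats in the usual way.\<close>

definition flat :: "'a om \<Rightarrow> 'a set \<Rightarrow> bool" where
  "flat M F \<longleftrightarrow> (\<exists>X\<in>covectors M. F = zero_set M X)"

definition cl :: "'a om \<Rightarrow> 'a set \<Rightarrow> 'a set" where
  "cl M S = \<Inter> {F. flat M F \<and> S \<subseteq> F}"

definition independent :: "'a om \<Rightarrow> 'a set \<Rightarrow> bool" where
  "independent M S \<longleftrightarrow> S \<subseteq> ground M \<and> (\<forall>e\<in>S. e \<notin> cl M (S - {e}))"

definition rk :: "'a om \<Rightarrow> 'a set \<Rightarrow> nat" where
  "rk M S = Max (card ` {I. I \<subseteq> S \<and> independent M I})"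

definition om_rank :: "'a om \<Rightarrow> nat" where
  "om_rank M = rk M (ground M)"

definition loop :: "'a om \<Rightarrow> 'a \<Rightarrow> bool" where
  "loop M e \<longleftrightarrow> e \<in> ground M \<and> e \<in> cl M {}"

definition coloop :: "'a om \<Rightarrow> 'a \<Rightarrow> bool" where
  "coloop M e \<longleftrightarrow> e \<in> ground M \<and> e \<notin> cl M (ground M - {e})"

definition general_position :: "'a om \<Rightarrow> 'a \<Rightarrow> bool" where
  "general_position M f \<longleftrightarrow>
     (\<forall>S. S \<subseteq> ground M - {f} \<and> rk M S < om_rank M \<longrightarrow> f \<notin> cl M S)"


subsection \<open>Minors\<close>

text \<open>The covectors of the contraction \<open>M / A\<close> are the restrictions to \<open>ground M - A\<close> of the
  covectors vanishing on \<open>A\<close>; those are already \<^term>\<open>Zero\<close> outside \<open>ground M - A\<close>, so the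
  restriction does not change them as functions.\<close>

definition contract :: "'a om \<Rightarrow> 'a set \<Rightarrow> 'a om" where
  "contract M A =
     \<lparr>ground = ground M - A, covectors = {X \<in> covectors M. \<forall>e\<in>A. X e = Zero}\<rparr>"

definition delete :: "'a om \<Rightarrow> 'a \<Rightarrow> 'a om" where
  "delete M p =
     \<lparr>ground = ground M - {p}, covectors = (\<lambda>X. X(p := Zero)) ` covectors M\<rparr>"


section \<open>Oriented matroid programs\<close>

definition comodular :: "'a om \<Rightarrow> 'a sign_vector \<Rightarrow> 'a sign_vector \<Rightarrow> bool" where
  "comodular M X Y \<longleftrightarrow>
     X \<in> cocircuits M \<and> Y \<in> cocircuits M \<and> X \<noteq> Y \<and> X \<noteq> - Y \<and>
     flat M (zero_set M (compose X Y)) \<and>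
     rk M (zero_set M (compose X Y)) + 2 = om_rank M"

text \<open>For comodular \<open>X\<close>, \<open>Y\<close> the support condition determines \<open>Z\<close> only up to sign; agreement with
  \<open>X \<circ> Y\<close> off the separation set, as in the covector elimination axiom, fixes the sign.\<close>

definition elimination ::
  "'a om \<Rightarrow> 'a sign_vector \<Rightarrow> 'a sign_vector \<Rightarrow> 'a \<Rightarrow> 'a sign_vector \<Rightarrow> bool" where
  "elimination M X Y e Z \<longleftrightarrow>
     e \<in> sep X Y \<and> Z \<in> cocircuits M \<and> Z e = Zero \<and> supp Z \<subseteq> supp (compose X Y) - {e} \<and>
     (\<forall>h. h \<notin> sep X Y \<longrightarrow> Z h = compose X Y h)"

definition om_program :: "'a om \<Rightarrow> 'a \<Rightarrow> 'a \<Rightarrow> bool" where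
  "om_program M g f \<longleftrightarrow>
     oriented_matroid M \<and> g \<in> ground M \<and> f \<in> ground M \<and> g \<noteq> f \<and> \<not> loop M g \<and> \<not> coloop M f"

definition program_vertices :: "'a om \<Rightarrow> 'a \<Rightarrow> 'a sign_vector set" where
  "program_vertices M g = {X \<in> cocircuits M. X g = Pos}"

definition program_edge :: "'a om \<Rightarrow> 'a \<Rightarrow> 'a sign_vector \<Rightarrow> 'a sign_vector \<Rightarrow> bool" where
  "program_edge M g X Y \<longleftrightarrow>
     X \<in> program_vertices M g \<and> Y \<in> program_vertices M g \<and> conformal X Y \<and> comodular M X Y"

definition forward_edge :: "'a om \<Rightarrow> 'a \<Rightarrow> 'a \<Rightarrow> 'a sign_vector \<Rightarrow> 'a sign_vector \<Rightarrow> bool" where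
  "forward_edge M g f X Y \<longleftrightarrow>
     program_edge M g X Y \<and> (\<exists>Z. elimination M (- X) Y g Z \<and> Z f = Pos)"

definition undirected_edge :: "'a om \<Rightarrow> 'a \<Rightarrow> 'a \<Rightarrow> 'a sign_vector \<Rightarrow> 'a sign_vector \<Rightarrow> bool" where
  "undirected_edge M g f X Y \<longleftrightarrow>
     program_edge M g X Y \<and> (\<exists>Z. elimination M (- X) Y g Z \<and> Z f = Zero)"

definition directed_cycle :: "'a om \<Rightarrow> 'a \<Rightarrow> 'a \<Rightarrow> 'a sign_vector list \<Rightarrow> bool" where
  "directed_cycle M g f Xs \<longleftrightarrow>
     distinct Xs \<and> set Xs \<subseteq> program_vertices M g \<and>
     (\<forall>i<length Xs. forward_edge M g f (Xs ! i) (Xs ! (Suc i mod length Xs)) \<or>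
                    undirected_edge M g f (Xs ! i) (Xs ! (Suc i mod length Xs))) \<and>
     (\<exists>i<length Xs. forward_edge M g f (Xs ! i) (Xs ! (Suc i mod length Xs)))"

definition euclidean_program :: "'a om \<Rightarrow> 'a \<Rightarrow> 'a \<Rightarrow> bool" where
  "euclidean_program M g f \<longleftrightarrow> om_program M g f \<and> (\<nexists>Xs. directed_cycle M g f Xs)"


section \<open>Lexicographic extensions\<close>

text \<open>\<open>M'\<close> is the single-element extension of \<open>M\<close> by \<open>p\<close> with localization \<open>\<sigma>\<close>: it restricts to
  \<open>M\<close>, has the same rank (so \<open>p\<close> is not a coloop), and every cocircuit \<open>Y\<close> of \<open>M\<close> extends to the
  cocircuit \<open>(Y, \<sigma> Y)\<close> of \<open>M'\<close>. By a theorem of Las Vergnas \<open>\<sigma>\<close> determines \<open>M'\<close>.\<close>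

definition extension_with_localization ::
  "'a om \<Rightarrow> 'a \<Rightarrow> ('a sign_vector \<Rightarrow> sign) \<Rightarrow> 'a om \<Rightarrow> bool" where
  "extension_with_localization M p \<sigma> M' \<longleftrightarrow>
     p \<notin> ground M \<and> oriented_matroid M' \<and> ground M' = insert p (ground M) \<and>
     delete M' p = M \<and> om_rank M' = om_rank M \<and>
     (\<forall>Y\<in>cocircuits M. Y(p := \<sigma> Y) \<in> cocircuits M')"

definition lex_localization :: "'a list \<Rightarrow> 'a sign_vector \<Rightarrow> sign" where
  "lex_localization es Y =
     (case find (\<lambda>e. Y e \<noteq> Zero) es of None \<Rightarrow> Zero | Some e \<Rightarrow> Y e)"

definition lexicographic_extension :: "'a om \<Rightarrow> 'a list \<Rightarrow> 'a \<Rightarrow> 'a om \<Rightarrow> bool" where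
  "lexicographic_extension M es p M' \<longleftrightarrow>
     extension_with_localization M p (lex_localization es) M'"

end

theory Submission
  imports Defs
begin

text \<open>
  The vertices of the program \<open>(M', p, f)\<close> are the cocircuits of \<open>M\<close> whose first nonzero entry along
  \<open>e\<^sub>1, \<dots>, e\<^sub>k\<close> is positive. The sign of \<open>f\<close> cannot decrease along a directed cycle, so it is a constant
  \<open>c\<close>, and \<open>c \<noteq> 0\<close> since otherwise every edge is undirected. Let \<open>e = e\<^sub>m\<close> be the first element that does
  not vanish on the whole cycle. An edge leaving the hyperplane \<open>e = 0\<close> is directed by \<open>- c\<close> and an
  edge entering it by \<open>c\<close>, so the cycle never meets \<open>e = 0\<close> and is a cycle of cocircuits of
  \<open>N = M / {e\<^sub>1, \<dots>, e\<^sub>m\<^sub>-\<^sub>1}\<close> with \<open>e = +\<close>. On the line through an edge, the point \<open>Z\<close> with \<open>p = 0\<close> is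
  infinitely close to the point \<open>W\<close> with \<open>e = 0\<close>: \<open>Z\<^sub>f = W\<^sub>f\<close> if \<open>W\<^sub>f \<noteq> 0\<close>, and \<open>Z\<^sub>f = - c \<sigma>(W)\<close> otherwise. As
  \<open>(N, e, f)\<close> is Euclidean, or \<open>f\<close> is parallel to \<open>e\<close> in \<open>N\<close>, all \<open>W\<^sub>f\<close> vanish. Hence the entries
  \<open>W\<^sub>e\<^sub>j\<close>, \<open>j > m\<close>, vanish successively because the programs \<open>(N, e, e\<^sub>j)\<close> are Euclidean, and no edge
  of the cycle is directed.
\<close>

section \<open>Sign vectors and covectors\<close>

lemma sign_neg_neg [simp]: "- (- s) = (s::sign)"
  by (cases s) auto

lemma sign_neg_eq_iff [simp]: "- s = Zero \<longleftrightarrow> s = Zero" "- s = Pos \<longleftrightarrow> s = Neg" "- s = Neg \<longleftrightarrow> s = Pos"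
  by (cases s; simp)+

lemma sv_neg_neg [simp]: "- (- X) = (X :: 'a sign_vector)"
  by (rule ext) simp

lemma om_finite: "oriented_matroid M \<Longrightarrow> finite (ground M)"
  and om_supp: "oriented_matroid M \<Longrightarrow> X \<in> covectors M \<Longrightarrow> X e \<noteq> Zero \<Longrightarrow> e \<in> ground M"
  and om_zero: "oriented_matroid M \<Longrightarrow> (\<lambda>_. Zero) \<in> covectors M"
  and om_neg: "oriented_matroid M \<Longrightarrow> X \<in> covectors M \<Longrightarrow> - X \<in> covectors M"
  and om_compose: "oriented_matroid M \<Longrightarrow> X \<in> covectors M \<Longrightarrow> Y \<in> covectors M
    \<Longrightarrow> compose X Y \<in> covectors M"
  by (auto simp: oriented_matroid_def supp_def)

lemma om_eliminate:
  "oriented_matroid M \<Longrightarrow> X \<in> covectors M \<Longrightarrow> Y \<in> covectors M \<Longrightarrow> e \<in> sep X Y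
    \<Longrightarrow> \<exists>Z\<in>covectors M. Z e = Zero \<and> (\<forall>h. h \<notin> sep X Y \<longrightarrow> Z h = compose X Y h)"
  unfolding oriented_matroid_def by blast

lemma compose_off_sep_left: "Y h = Zero \<Longrightarrow> h \<notin> sep X Y \<and> compose X Y h = X h"
  and compose_off_sep_right: "X h = Zero \<Longrightarrow> h \<notin> sep X Y \<and> compose X Y h = Y h"
  and compose_off_sep_eq: "X h = Y h \<Longrightarrow> h \<notin> sep X Y \<and> compose X Y h = X h"
  by (cases "Y h"; auto simp: sep_def compose_def)+

lemma om_eliminate_cases:
  assumes "oriented_matroid M" "X \<in> covectors M" "Y \<in> covectors M" "X e = - Y e" "X e \<noteq> Zero"
  shows "\<exists>Z\<in>covectors M. Z e = Zero \<and> (\<forall>h. Y h = Zero \<longrightarrow> Z h = X h) \<and>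
    (\<forall>h. X h = Zero \<longrightarrow> Z h = Y h) \<and> (\<forall>h. X h = Y h \<longrightarrow> Z h = X h)"
proof -
  obtain Z where "Z \<in> covectors M" "Z e = Zero" and Z: "\<And>h. h \<notin> sep X Y \<Longrightarrow> Z h = compose X Y h"
    using om_eliminate[OF assms(1-3), of e] assms(4,5) unfolding sep_def by blast
  then show ?thesis
    using compose_off_sep_left[of Y _ X] compose_off_sep_right[of X _ Y]
      compose_off_sep_eq[of X _ Y] by metis
qed

section \<open>Cocircuits as minimal nonzero covectors\<close>

lemma cocircuit_neg: "oriented_matroid M \<Longrightarrow> X \<in> cocircuits M \<Longrightarrow> - X \<in> cocircuits M"
proof -
  assume M: "oriented_matroid M" and X: "X \<in> cocircuits M"
  have "Y = - X" if Y: "Y \<in> covectors M" "Y \<noteq> (\<lambda>_. Zero)" "sv_le Y (- X)" for Y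
  proof -
    have "- Y \<noteq> (\<lambda>_. Zero)" using Y(2) by (auto simp: fun_eq_iff)
    moreover have "sv_le (- Y) X" using Y(3) unfolding sv_le_def by (metis sign_neg_neg uminus_apply sign_neg_eq_iff(1))
    ultimately have "- Y = X" using X om_neg[OF M Y(1)] by (auto simp: cocircuits_def)
    then show ?thesis by (metis sv_neg_neg)
  qed
  moreover have "- X \<noteq> (\<lambda>_. Zero)" using X by (auto simp: fun_eq_iff cocircuits_def)
  ultimately show ?thesis using X om_neg[OF M] by (auto simp: cocircuits_def)
qed

text \<open>Induction on the support size: below a covector that is not minimal lies a smaller
  nonzero \<open>U\<close>. Either \<open>U\<close> is nonzero at \<open>e\<close>, or eliminating
  against \<open>- U\<close> shrinks the support without touching \<open>e\<close>.\<close>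

lemma cocircuit_support_exists:
  assumes M: "oriented_matroid M" and V: "V \<in> covectors M" "V e \<noteq> Zero"
  shows "\<exists>Y\<in>cocircuits M. Y e \<noteq> Zero"
  using V
proof (induction "card (supp V)" arbitrary: V rule: less_induct)
  case less
  have fin: "finite (supp V)"
    by (rule finite_subset[OF _ om_finite[OF M]]) (use om_supp[OF M less.prems(1)] in \<open>auto simp: supp_def\<close>)
  show ?case
  proof (cases "V \<in> cocircuits M")
    case False
    then obtain U where U: "U \<in> covectors M" "U \<noteq> (\<lambda>_. Zero)" "sv_le U V" "U \<noteq> V"
      using less.prems by (auto simp: cocircuits_def)
    have "\<exists>Q\<in>covectors M. Q e \<noteq> Zero \<and> supp Q \<subset> supp V"
    proof (cases "U e = Zero")
      case True
      obtain g where g: "U g \<noteq> Zero" using U(2) by auto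
      then have Vg: "V g = U g" using U(3) by (metis sv_le_def)
      have "V g = - (- U) g" "V g \<noteq> Zero" using g Vg by simp_all
      then obtain Q where Q: "Q \<in> covectors M" "Q g = Zero" "\<forall>h. (-U) h = Zero \<longrightarrow> Q h = V h"
        using om_eliminate_cases[OF M less.prems(1) om_neg[OF M U(1)], of g] by blast
      have "supp Q \<subseteq> supp V"
        using Q(3) U(3) unfolding supp_def sv_le_def by (smt (verit) mem_Collect_eq subsetI sign_neg_eq_iff(1) uminus_apply)
      moreover have "g \<in> supp V - supp Q" using g Vg Q(2) by (simp add: supp_def)
      moreover have "Q e \<noteq> Zero" using Q(3) True less.prems by simp
      ultimately show ?thesis using Q(1) by blast
    next
      case False
      have "supp U \<subseteq> supp V" using U(3) by (auto simp: supp_def sv_le_def)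
      moreover obtain h where "U h \<noteq> V h" using U(4) by auto
      then have "h \<in> supp V - supp U" using U(3) unfolding supp_def sv_le_def by force
      ultimately show ?thesis using False U(1) by blast
    qed
    then show ?thesis using less.hyps fin by (meson psubset_card_mono)
  qed (use less.prems in blast)
qed

section \<open>Closure and rank\<close>

text \<open>Flats are zero sets, so closure is a vanishing condition on covectors. The conjunct
  \<open>e \<in> ground M\<close> comes from the zero covector, whose zero set is the whole ground
  set.\<close>

lemma in_cl_iff:
  assumes M: "oriented_matroid M" and S: "S \<subseteq> ground M"
  shows "e \<in> cl M S \<longleftrightarrow> e \<in> ground M \<and> (\<forall>X\<in>covectors M. (\<forall>s\<in>S. X s = Zero) \<longrightarrow> X e = Zero)"
proof -
  have "e \<in> cl M S \<longleftrightarrow> (\<forall>X\<in>covectors M. (\<forall>s\<in>S. X s = Zero) \<longrightarrow> e \<in> ground M \<and> X e = Zero)"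
    using S unfolding cl_def flat_def zero_set_def by blast
  then show ?thesis using om_zero[OF M] by auto
qed

lemma in_clD:
  "oriented_matroid M \<Longrightarrow> S \<subseteq> ground M \<Longrightarrow> e \<in> cl M S \<Longrightarrow> X \<in> covectors M \<Longrightarrow> \<forall>s\<in>S. X s = Zero
    \<Longrightarrow> X e = Zero"
  by (simp add: in_cl_iff)

lemma not_in_clI:
  "oriented_matroid M \<Longrightarrow> S \<subseteq> ground M \<Longrightarrow> X \<in> covectors M \<Longrightarrow> \<forall>s\<in>S. X s = Zero \<Longrightarrow> X e \<noteq> Zero
    \<Longrightarrow> e \<notin> cl M S"
  using in_clD[of M S e X] by blast

lemma not_in_clE:
  assumes "oriented_matroid M" "S \<subseteq> ground M" "e \<in> ground M" "e \<notin> cl M S"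
  obtains X where "X \<in> covectors M" "\<forall>s\<in>S. X s = Zero" "X e \<noteq> Zero"
  using assms in_cl_iff[of M S e] by blast

lemma cl_least:
  assumes M: "oriented_matroid M" and S: "S \<subseteq> ground M" and T: "T \<subseteq> ground M" and ST: "S \<subseteq> cl M T"
  shows "cl M S \<subseteq> cl M T"
proof
  fix e assume e: "e \<in> cl M S"
  have "X e = Zero" if X: "X \<in> covectors M" "\<forall>s\<in>T. X s = Zero" for X
  proof (rule in_clD[OF M S e X(1)])
    show "\<forall>s\<in>S. X s = Zero" using in_clD[OF M T _ X] ST by blast
  qed
  then show "e \<in> cl M T" using e in_cl_iff[OF M S] in_cl_iff[OF M T] by simp
qed

lemma subset_cl:
  assumes "oriented_matroid M" "S \<subseteq> ground M" shows "S \<subseteq> cl M S"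
  using assms(2) by (auto simp: in_cl_iff[OF assms])

lemma cl_mono:
  "oriented_matroid M \<Longrightarrow> T \<subseteq> ground M \<Longrightarrow> S \<subseteq> T \<Longrightarrow> cl M S \<subseteq> cl M T"
  by (rule cl_least) (simp_all add: order_trans[OF _ subset_cl])

text \<open>Otherwise \<open>b\<close> can be eliminated between a covector vanishing on
  \<open>S\<close> but not at \<open>a\<close> and one vanishing on \<open>insert a S\<close> but
  not at \<open>b\<close>. The value at \<open>a\<close> survives, against
  \<open>aSb\<close>.\<close>

lemma cl_exchange:
  assumes M: "oriented_matroid M" and S: "S \<subseteq> ground M" and ab: "a \<in> ground M" "b \<in> ground M"
    and aS: "a \<notin> cl M S" and aSb: "a \<in> cl M (insert b S)"
  shows "b \<in> cl M (insert a S)"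
proof (rule ccontr)
  have Sab: "insert a S \<subseteq> ground M" "insert b S \<subseteq> ground M" using S ab by auto
  assume "b \<notin> cl M (insert a S)"
  then obtain Y where Y: "Y \<in> covectors M" "\<forall>s\<in>insert a S. Y s = Zero" "Y b \<noteq> Zero"
    by (rule not_in_clE[OF M Sab(1) ab(2)])
  obtain X where X: "X \<in> covectors M" "\<forall>s\<in>S. X s = Zero" "X a \<noteq> Zero"
    by (rule not_in_clE[OF M S ab(1) aS])
  have Xb: "X b \<noteq> Zero" using in_clD[OF M Sab(2) aSb X(1)] X(2,3) by auto
  \<comment> \<open>Covectors come in antipodal pairs, so \<open>Y\<close> can be chosen opposite to
    \<open>X\<close> at \<open>b\<close>.\<close>
  have "X b = - Y b \<or> X b = - ((- Y) b)" using Xb Y(3) by (cases "X b"; cases "Y b") auto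
  moreover have "\<forall>s\<in>insert a S. (- Y) s = Zero" using Y(2) by simp
  ultimately obtain Y' where Y': "Y' \<in> covectors M" "\<forall>s\<in>insert a S. Y' s = Zero" "X b = - Y' b"
    using Y(1,2) om_neg[OF M Y(1)] by metis
  obtain Z where Z: "Z \<in> covectors M" "Z b = Zero" "\<forall>h. Y' h = Zero \<longrightarrow> Z h = X h"
    using om_eliminate_cases[OF M X(1) Y'(1) Y'(3) Xb] by blast
  have "Z a = X a" "\<forall>s\<in>insert b S. Z s = Zero" using Z(2,3) Y'(2) X(2) by simp_all
  then show False using in_clD[OF M Sab(2) aSb Z(1)] X(3) by simp
qed

section \<open>Independent sets, bases and rank\<close>

lemma independent_subset:
  assumes M: "oriented_matroid M" and I: "independent M I" and J: "J \<subseteq> I"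
  shows "independent M J"
proof -
  have IE: "I \<subseteq> ground M" using I by (simp add: independent_def)
  have "e \<notin> cl M (J - {e})" if "e \<in> J" for e
  proof -
    have "cl M (J - {e}) \<subseteq> cl M (I - {e})" using IE J by (intro cl_mono[OF M]) auto
    then show ?thesis using I J that by (auto simp: independent_def)
  qed
  then show ?thesis using IE J by (auto simp: independent_def)
qed

lemma independent_insert:
  assumes M: "oriented_matroid M" and I: "independent M I" and b: "b \<in> ground M" "b \<notin> cl M I"
  shows "independent M (insert b I)"
proof -
  have IE: "I \<subseteq> ground M" using I by (simp add: independent_def)
  have bI: "b \<notin> I" using b subset_cl[OF M IE] by blast
  have "x \<notin> cl M (insert b I - {x})" if x: "x \<in> I" for x
  proof
    assume "x \<in> cl M (insert b I - {x})"
    moreover have "insert b I - {x} = insert b (I - {x})" using x bI by auto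
    ultimately have "b \<in> cl M (insert x (I - {x}))"
      using cl_exchange[OF M, of "I - {x}" x b] x I IE b by (auto simp: independent_def)
    then show False using b x by (simp add: insert_absorb)
  qed
  then show ?thesis using bI b IE by (auto simp: independent_def)
qed

text \<open>Steinitz exchange: an element \<open>a\<close> of \<open>I - J\<close> is replaced by an
  element of \<open>J\<close> outside \<open>cl M (I - {a})\<close>. This keeps independence and
  cardinality while \<open>I - J\<close> shrinks.\<close>

lemma independent_card_le:
  assumes M: "oriented_matroid M" and "independent M I" and J: "J \<subseteq> ground M" and "I \<subseteq> cl M J"
  shows "card I \<le> card J"
  using assms(2,4)
proof (induction "card (I - J)" arbitrary: I rule: less_induct)
  case less
  have IE: "I \<subseteq> ground M" using less.prems by (simp add: independent_def)
  have fin: "finite I" "finite J" using IE J om_finite[OF M] by (auto intro: finite_subset)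
  show ?case
  proof (cases "I \<subseteq> J")
    case True then show ?thesis using fin by (simp add: card_mono)
  next
    case False
    then obtain a where a: "a \<in> I" "a \<notin> J" by blast
    have "\<not> J \<subseteq> cl M (I - {a})"
    proof
      assume "J \<subseteq> cl M (I - {a})"
      then have "cl M J \<subseteq> cl M (I - {a})" using cl_least[OF M J] IE by blast
      then show False using a less.prems by (auto simp: independent_def)
    qed
    then obtain b where b: "b \<in> J" "b \<notin> cl M (I - {a})" by blast
    have "I - {a} \<subseteq> cl M (I - {a})" using IE by (intro subset_cl[OF M]) blast
    then have bI: "b \<notin> I - {a}" using b by blast
    let ?I = "insert b (I - {a})"
    have "independent M ?I"
      using b J by (intro independent_insert[OF M] independent_subset[OF M less.prems(1)]) auto
    moreover have "?I \<subseteq> cl M J" using b subset_cl[OF M J] less.prems by blast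
    moreover have "?I - J = I - J - {a}" using b by blast
    then have "card (?I - J) < card (I - J)" using a fin card_Diff1_less[of "I - J" a] by simp
    ultimately have "card ?I \<le> card J" using less.hyps by blast
    moreover have "card ?I = card I" using bI card_Suc_Diff1[OF fin(1) a(1)] fin(1) by simp
    ultimately show ?thesis by simp
  qed
qed

lemma rk_eq_card_basis:
  assumes M: "oriented_matroid M" and S: "S \<subseteq> ground M"
    and B: "independent M B" "B \<subseteq> S" "S \<subseteq> cl M B"
  shows "rk M S = card B"
proof -
  have BE: "B \<subseteq> ground M" using B S by blast
  have fS: "finite S" using S om_finite[OF M] by (auto intro: finite_subset)
  have "finite {I. I \<subseteq> S \<and> independent M I}" using fS by simp
  moreover have "card I \<le> card B" if "I \<subseteq> S" "independent M I" for I
    using independent_card_le[OF M that(2) BE] that(1) B by blast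
  ultimately show ?thesis unfolding rk_def using B by (intro Max_eqI) auto
qed

lemma basis_extension:
  assumes M: "oriented_matroid M" and S: "S \<subseteq> ground M" and A: "independent M A" "A \<subseteq> S"
  obtains B where "A \<subseteq> B" "independent M B" "B \<subseteq> S" "S \<subseteq> cl M B"
proof -
  let ?C = "{B. A \<subseteq> B \<and> B \<subseteq> S \<and> independent M B}"
  have fS: "finite S" using S om_finite[OF M] by (auto intro: finite_subset)
  have "finite ?C" using fS by simp
  moreover have "?C \<noteq> {}" using A by blast
  ultimately obtain B where B: "B \<in> ?C" "\<And>B'. B' \<in> ?C \<Longrightarrow> B \<subseteq> B' \<Longrightarrow> B = B'"
    by (meson finite_has_maximal)
  have "S \<subseteq> cl M B"
  proof
    fix x assume x: "x \<in> S"
    show "x \<in> cl M B"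
    proof (rule ccontr)
      assume n: "x \<notin> cl M B"
      then have "insert x B \<in> ?C" using B(1) x S independent_insert[OF M] by blast
      then have "x \<in> B" using B(2) by blast
      then show False using n subset_cl[OF M] B(1) S by blast
    qed
  qed
  then show ?thesis using that B(1) by blast
qed

lemma independent_empty: "independent M {}"
  by (simp add: independent_def)

lemma rk_insert_le:
  assumes M: "oriented_matroid M" and S: "S \<subseteq> ground M" "x \<in> ground M"
  shows "rk M (insert x S) \<le> rk M S + 1"
proof -
  obtain B where B: "independent M B" "B \<subseteq> S" "S \<subseteq> cl M B"
    using basis_extension[OF M S(1) independent_empty empty_subsetI] by metis
  obtain C where C: "independent M C" "C \<subseteq> insert x S" "insert x S \<subseteq> cl M C"
    using basis_extension[OF M _ independent_empty, of "insert x S"] S by (metis empty_subsetI insert_subset)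
  have BE: "insert x B \<subseteq> ground M" using B S by blast
  have "insert x S \<subseteq> cl M (insert x B)"
    using B cl_mono[OF M BE, of B] subset_cl[OF M BE] by blast
  then have "card C \<le> card (insert x B)" using independent_card_le[OF M C(1) BE] C by blast
  also have "\<dots> \<le> card B + 1" by (cases "finite B") (simp_all add: card_insert_if)
  finally show ?thesis using rk_eq_card_basis[OF M] B C S by simp
qed

text \<open>Otherwise a basis of \<open>L\<close> followed by \<open>g\<close>, \<open>h\<close>,
  \<open>x\<close> is independent with \<open>om_rank M + 1\<close> elements: \<open>V\<close>
  separates \<open>h\<close> from \<open>L\<close> and \<open>g\<close>, and \<open>U\<close>
  separates \<open>x\<close> from \<open>L\<close>, \<open>g\<close> and \<open>h\<close>.\<close>

lemma corank_two_hyperplane: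
  assumes M: "oriented_matroid M" and L: "L \<subseteq> ground M" "rk M L + 2 = om_rank M"
    and g: "g \<in> ground M" "g \<notin> cl M L"
    and U: "U \<in> covectors M" "\<forall>s\<in>L. U s = Zero" "U g = Zero" "U x \<noteq> Zero"
    and V: "V \<in> covectors M" "\<forall>s\<in>L. V s = Zero" "V g = Zero"
    and h: "U h = Zero"
  shows "V h = Zero"
proof (rule ccontr)
  assume Vh: "V h \<noteq> Zero"
  obtain B where B: "independent M B" "B \<subseteq> L" "L \<subseteq> cl M B"
    using basis_extension[OF M L(1) independent_empty empty_subsetI] by metis
  have BE: "B \<subseteq> ground M" using B L by blast
  have fB: "finite B" using BE om_finite[OF M] by (auto intro: finite_subset)
  have UB: "\<forall>s\<in>B. U s = Zero" and VB: "\<forall>s\<in>B. V s = Zero" using U(2) V(2) B(2) by auto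
  have "g \<notin> cl M B" using g(2) cl_mono[OF M L(1) B(2)] by auto
  then have 1: "independent M (insert g B)" using independent_insert[OF M B(1)] g by blast
  have hE: "h \<in> ground M" using om_supp[OF M V(1) Vh] .
  have "h \<notin> cl M (insert g B)" using V(3) VB g(1) BE by (intro not_in_clI[OF M _ V(1) _ Vh]) simp_all
  then have 2: "independent M (insert h (insert g B))" using independent_insert[OF M 1] hE by blast
  have xE: "x \<in> ground M" using om_supp[OF M U(1) U(4)] .
  have "x \<notin> cl M (insert h (insert g B))"
    using U(3) h UB g(1) BE hE by (intro not_in_clI[OF M _ U(1) _ U(4)]) simp_all
  then have 3: "independent M (insert x (insert h (insert g B)))" using independent_insert[OF M 2] xE by blast
  have "B \<subseteq> cl M B" "insert g B \<subseteq> cl M (insert g B)"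
    "insert h (insert g B) \<subseteq> cl M (insert h (insert g B))"
    using BE hE g(1) by (intro subset_cl[OF M]; simp)+
  then have "g \<notin> B" "h \<notin> insert g B" "x \<notin> insert h (insert g B)"
    using \<open>g \<notin> cl M B\<close> \<open>h \<notin> cl M (insert g B)\<close> \<open>x \<notin> cl M (insert h (insert g B))\<close>
    by auto
  then have "card (insert x (insert h (insert g B))) = card B + 3" using fB by simp
  moreover obtain C where C: "independent M C" "C \<subseteq> ground M" "ground M \<subseteq> cl M C"
    using basis_extension[OF M order_refl independent_empty empty_subsetI] by metis
  have "card (insert x (insert h (insert g B))) \<le> card C"
    using g(1) hE xE BE by (intro independent_card_le[OF M 3 C(2)] order_trans[OF _ C(3)]) simp
  moreover have "card C = card B + 2"
    using rk_eq_card_basis[OF M order_refl C] rk_eq_card_basis[OF M L(1) B] L(2) by (simp add: om_rank_def)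
  ultimately show False by simp
qed

section \<open>Contraction and deletion\<close>

lemma contract_simps [simp]:
  "ground (contract M A) = ground M - A"
  "covectors (contract M A) = {X \<in> covectors M. \<forall>e\<in>A. X e = Zero}"
  by (simp_all add: contract_def)

lemma oriented_matroid_contract:
  assumes M: "oriented_matroid M"
  shows "oriented_matroid (contract M A)"
  unfolding oriented_matroid_def
proof (intro conjI ballI)
  fix X Y e
  assume XY: "X \<in> covectors (contract M A)" "Y \<in> covectors (contract M A)"
  then have XY': "X \<in> covectors M" "Y \<in> covectors M" "\<forall>a\<in>A. X a = Zero" "\<forall>a\<in>A. Y a = Zero"
    by simp_all
  then show "compose X Y \<in> covectors (contract M A)"
    using om_compose[OF M] by (simp add: compose_def)
  assume e: "e \<in> sep X Y"
  obtain Z where Z: "Z \<in> covectors M" "Z e = Zero" "\<forall>h. h \<notin> sep X Y \<longrightarrow> Z h = compose X Y h"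
    using om_eliminate[OF M XY'(1,2) e] by (elim bexE conjE)
  have "\<forall>a\<in>A. Z a = Zero" using Z(3) XY'(3,4) by (simp add: sep_def compose_def)
  then show "\<exists>Z\<in>covectors (contract M A). Z e = Zero \<and> (\<forall>h. h \<notin> sep X Y \<longrightarrow> Z h = compose X Y h)"
    by (intro bexI[of _ Z] conjI Z(2,3)) (simp add: Z(1))
qed (use om_finite[OF M] om_zero[OF M] om_neg[OF M] om_supp[OF M] in \<open>auto simp: supp_def\<close>)

lemma cl_contract:
  assumes M: "oriented_matroid M" and A: "A \<subseteq> ground M" and S: "S \<subseteq> ground M - A"
  shows "cl (contract M A) S = cl M (S \<union> A) - A"
proof -
  have SA: "S \<union> A \<subseteq> ground M" "S \<subseteq> ground (contract M A)" using A S by auto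
  show ?thesis
    by (auto simp: ball_Un in_cl_iff[OF M SA(1)] in_cl_iff[OF oriented_matroid_contract[OF M] SA(2)])
qed

text \<open>If \<open>A\<close> is extended to a basis \<open>B\<close> of \<open>S\<close>, then
  \<open>B - A\<close> is a basis of \<open>S - A\<close> in the contraction.\<close>

lemma rk_contract:
  assumes M: "oriented_matroid M" and A: "independent M A" "A \<subseteq> S" and S: "S \<subseteq> ground M"
  shows "rk (contract M A) (S - A) + card A = rk M S"
proof -
  let ?N = "contract M A"
  have N: "oriented_matroid ?N" using oriented_matroid_contract[OF M] .
  obtain B where B: "A \<subseteq> B" "independent M B" "B \<subseteq> S" "S \<subseteq> cl M B"
    using basis_extension[OF M S A] by metis
  have AE: "A \<subseteq> ground M" using A S by blast
  have fB: "finite B" by (rule finite_subset[OF _ om_finite[OF M]]) (use B S in blast)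
  have "b \<notin> cl ?N (B - A - {b})" if "b \<in> B - A" for b
  proof -
    have "cl ?N (B - A - {b}) = cl M (B - A - {b} \<union> A) - A"
      by (rule cl_contract[OF M AE]) (use B S in blast)
    moreover have "B - A - {b} \<union> A = B - {b}" using B that by blast
    ultimately show ?thesis using B that by (simp add: independent_def)
  qed
  then have 1: "independent ?N (B - A)" using B S by (auto simp: independent_def)
  have "cl ?N (B - A) = cl M (B - A \<union> A) - A"
    by (rule cl_contract[OF M AE]) (use B S in blast)
  then have 2: "S - A \<subseteq> cl ?N (B - A)" using B by (auto simp: Un_absorb2)
  have "rk ?N (S - A) = card (B - A)"
    by (rule rk_eq_card_basis[OF N _ 1 _ 2]) (use B S in auto)
  moreover have "card B = card (B - A) + card A" using fB B(1) by (metis card_Diff_subset card_mono finite_subset le_add_diff_inverse2)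
  ultimately show ?thesis using rk_eq_card_basis[OF M S B(2-4)] by simp
qed

lemma cocircuit_contract:
  "X \<in> cocircuits M \<Longrightarrow> \<forall>e\<in>A. X e = Zero \<Longrightarrow> X \<in> cocircuits (contract M A)"
  by (simp add: cocircuits_def)

text \<open>The rank of the common zero set and the total rank both drop by \<open>card A\<close>.
  This moves the edges of a cycle into the contraction.\<close>

lemma comodular_contract:
  assumes M: "oriented_matroid M" and A: "independent M A"
    and XY: "comodular M X Y" and X: "\<forall>e\<in>A. X e = Zero" and Y: "\<forall>e\<in>A. Y e = Zero"
  shows "comodular (contract M A) X Y"
proof -
  let ?N = "contract M A" and ?L = "zero_set M (compose X Y)"
  have AE: "A \<subseteq> ground M" using A by (simp add: independent_def)
  have AL: "A \<subseteq> ?L" using AE X Y by (auto simp: zero_set_def compose_def)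
  have LE: "?L \<subseteq> ground M" by (auto simp: zero_set_def)
  have z: "zero_set ?N (compose X Y) = ?L - A" by (auto simp: zero_set_def)
  have co: "X \<in> cocircuits M" "Y \<in> cocircuits M" "X \<noteq> Y" "X \<noteq> - Y"
    and rk: "rk M ?L + 2 = rk M (ground M)"
    using XY by (simp_all add: comodular_def om_rank_def)
  have "compose X Y \<in> covectors M" using om_compose[OF M] co by (simp add: cocircuits_def)
  then have "compose X Y \<in> covectors ?N" using X Y by (simp add: compose_def)
  then have "flat ?N (zero_set ?N (compose X Y))" unfolding flat_def by blast
  moreover have "rk ?N (zero_set ?N (compose X Y)) + 2 = om_rank ?N"
    using rk_contract[OF M A AL LE] rk_contract[OF M A AE order_refl] rk
    by (simp add: z om_rank_def)
  ultimately show ?thesis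
    using co X Y cocircuit_contract[of _ M A] by (simp add: comodular_def)
qed

section \<open>Deletion of one element\<close>

lemma delete_simps [simp]:
  "ground (delete M p) = ground M - {p}"
  "covectors (delete M p) = (\<lambda>X. X(p := Zero)) ` covectors M"
  by (simp_all add: delete_def)

text \<open>Vanishing on a set that avoids \<open>p\<close> does not depend on the value at
  \<open>p\<close>, so closures agree off \<open>p\<close> and the independent sets
  coincide.\<close>

lemma rk_delete:
  assumes M: "oriented_matroid M" and D: "oriented_matroid (delete M p)" and S: "S \<subseteq> ground M - {p}"
  shows "rk (delete M p) S = rk M S"
proof -
  have cl: "cl (delete M p) T = cl M T - {p}" if T: "T \<subseteq> ground M - {p}" for T
  proof -
    have T': "T \<subseteq> ground M" "T \<subseteq> ground (delete M p)" "p \<notin> T" using T by auto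
    have "(\<forall>s\<in>T. (X(p := Zero)) s = Zero) \<longleftrightarrow> (\<forall>s\<in>T. X s = Zero)" for X
      using T'(3) by auto
    then have "x \<in> cl (delete M p) T \<longleftrightarrow> x \<in> cl M T - {p}" for x
      unfolding in_cl_iff[OF D T'(2)] Diff_iff in_cl_iff[OF M T'(1)] delete_simps ball_simps by auto
    then show ?thesis by blast
  qed
  have "independent (delete M p) I \<longleftrightarrow> independent M I" if I: "I \<subseteq> S" for I
  proof -
    have "cl (delete M p) (I - {e}) = cl M (I - {e}) - {p}" for e using I S by (intro cl) auto
    moreover have "p \<notin> I" "I \<subseteq> ground M" using I S by auto
    ultimately show ?thesis unfolding independent_def delete_simps by auto
  qed
  then have "{I. I \<subseteq> S \<and> independent (delete M p) I} = {I. I \<subseteq> S \<and> independent M I}" by auto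
  then show ?thesis unfolding rk_def by simp
qed

section \<open>Edges of a single element extension\<close>

text \<open>If \<open>Y\<close> were nonzero wherever \<open>X\<close> is, conformality would put
  \<open>X\<close> below \<open>Y\<close>, against the minimality of \<open>Y\<close>.\<close>

lemma cocircuit_not_nested:
  assumes "X \<in> cocircuits M" "Y \<in> cocircuits M" "conformal X Y" "X \<noteq> Y"
  shows "\<exists>h. X h \<noteq> Zero \<and> Y h = Zero"
proof (rule ccontr)
  assume n: "\<nexists>h. X h \<noteq> Zero \<and> Y h = Zero"
  have "X h = Zero \<or> X h = Y h" for h
  proof -
    have "h \<notin> sep X Y" using assms(3) by (simp add: conformal_def)
    moreover have "X h = Zero \<or> Y h \<noteq> Zero" using n by blast
    ultimately show ?thesis by (cases "X h"; cases "Y h") (simp_all add: sep_def)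
  qed
  then show False using assms by (auto simp: cocircuits_def sv_le_def)
qed

lemma conformal_sym: "conformal X Y \<Longrightarrow> conformal Y X"
proof -
  assume "conformal X Y"
  then have "\<not> (X h = - Y h \<and> X h \<noteq> Zero)" for h by (auto simp: conformal_def sep_def)
  then have "\<not> (Y h = - X h \<and> Y h \<noteq> Zero)" for h by (metis sign_neg_neg sign_neg_eq_iff(1))
  then show ?thesis by (auto simp: conformal_def sep_def)
qed

text \<open>An edge of the program on \<open>M'\<close> for an arbitrary localization. As
  \<open>p\<close> is nonzero at \<open>X\<close>, it is not among the elements that must vanish on
  the line, so a covector of \<open>M\<close> can be lifted to the line whatever its value at
  \<open>p\<close>.\<close>

locale extension_edge =
  fixes M M' :: "'a om" and p :: 'a and \<sigma> :: "'a sign_vector \<Rightarrow> sign" and X Y :: "'a sign_vector"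
  assumes M: "oriented_matroid M" and ext: "extension_with_localization M p \<sigma> M'"
    and comod: "comodular M' X Y" and conf: "conformal X Y" and Xp: "X p = Pos" and Yp: "Y p = Pos"
begin

text \<open>The rank two contraction of \<open>M'\<close> spanned by \<open>X\<close> and \<open>Y\<close>. Covectors are \<^term>\<open>Zero\<close> outside the
  ground set, so \<open>s\<close> may range over the whole type.\<close>

definition line :: "'a sign_vector \<Rightarrow> bool" where
  "line V \<longleftrightarrow> V \<in> covectors M' \<and> (\<forall>s. X s = Zero \<and> Y s = Zero \<longrightarrow> V s = Zero)"

lemma M': "oriented_matroid M'"
  and M'_ground: "ground M' = insert p (ground M)"
  and p_notin: "p \<notin> ground M"
  and M_delete: "M = delete M' p"
  and M_covectors: "covectors M = (\<lambda>X. X(p := Zero)) ` covectors M'"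
  using ext delete_simps(2)[of M' p] by (auto simp: extension_with_localization_def)

lemma coX: "X \<in> cocircuits M'" and coY: "Y \<in> cocircuits M'"
  using comod by (auto simp: comodular_def)

lemma line_X: "line X" and line_Y: "line Y"
  using coX coY by (auto simp: line_def cocircuits_def)

lemma line_neg: "line V \<Longrightarrow> line (- V)"
  by (simp add: line_def om_neg[OF M'])

lemma line_supp: "line V \<Longrightarrow> V s \<noteq> Zero \<Longrightarrow> X s \<noteq> Zero \<or> Y s \<noteq> Zero"
  by (auto simp: line_def)

lemma line_eliminate:
  assumes "line U" "line V" "U e = - V e" "U e \<noteq> Zero"
  obtains Q where "line Q" "Q e = Zero" "\<forall>h. V h = Zero \<longrightarrow> Q h = U h"
    "\<forall>h. U h = Zero \<longrightarrow> Q h = V h" "\<forall>h. U h = V h \<longrightarrow> Q h = U h"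
proof -
  have UV: "U \<in> covectors M'" "V \<in> covectors M'" using assms by (simp_all add: line_def)
  obtain Q where Q: "Q \<in> covectors M'" "Q e = Zero" "\<forall>h. V h = Zero \<longrightarrow> Q h = U h"
    "\<forall>h. U h = Zero \<longrightarrow> Q h = V h" "\<forall>h. U h = V h \<longrightarrow> Q h = U h"
    using om_eliminate_cases[OF M' UV assms(3,4)] by (elim bexE conjE)
  have "line Q" using Q(1,3) assms(1,2) by (simp add: line_def)
  then show thesis using that Q by blast
qed

text \<open>These elements of \<open>M\<close> separate the endpoints. At them the elimination of
  \<open>p\<close> has a known sign, which later fixes the choice between antipodal points.\<close>

lemma only_X: "\<exists>h. X h \<noteq> Zero \<and> Y h = Zero \<and> h \<noteq> p"
  and only_Y: "\<exists>h. Y h \<noteq> Zero \<and> X h = Zero \<and> h \<noteq> p"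
proof -
  have "X \<noteq> Y" using comod by (auto simp: comodular_def)
  then show "\<exists>h. X h \<noteq> Zero \<and> Y h = Zero \<and> h \<noteq> p" "\<exists>h. Y h \<noteq> Zero \<and> X h = Zero \<and> h \<noteq> p"
    using cocircuit_not_nested[OF coX coY conf] cocircuit_not_nested[OF coY coX conformal_sym[OF conf]]
      Xp Yp by force+
qed

text \<open>The line has rank two, so one nontrivial zero \<open>g\<close> determines the zero set
  of a point on it. \<open>compose X Y\<close> shows that \<open>g\<close> is outside the closure of
  the common zero set.\<close>

lemma line_vanish:
  assumes U: "line U" "U g = Zero" "U x \<noteq> Zero" and V: "line V" "V g = Zero"
    and g: "X g \<noteq> Zero \<or> Y g \<noteq> Zero" and h: "U h = Zero"
  shows "V h = Zero"
proof -
  let ?L = "zero_set M' (compose X Y)"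
  have XY: "X \<in> covectors M'" "Y \<in> covectors M'" using line_X line_Y by (simp_all add: line_def)
  have L: "?L \<subseteq> ground M'" by (auto simp: zero_set_def)
  have rk: "rk M' ?L + 2 = om_rank M'" using comod by (simp add: comodular_def)
  have gE: "g \<in> ground M'" using g om_supp[OF M' XY(1)] om_supp[OF M' XY(2)] by blast
  have gL: "g \<notin> cl M' ?L"
  proof (rule not_in_clI[OF M' L om_compose[OF M' XY]])
    show "\<forall>s\<in>?L. compose X Y s = Zero" by (simp add: zero_set_def)
    show "compose X Y g \<noteq> Zero" using g by (simp add: compose_def)
  qed
  have "\<forall>s\<in>?L. W s = Zero" if "line W" for W
    using that by (auto simp: zero_set_def line_def compose_def split: if_splits)
  then have UL: "\<forall>s\<in>?L. U s = Zero" and VL: "\<forall>s\<in>?L. V s = Zero" using U(1) V(1) by blast+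
  have UV: "U \<in> covectors M'" "V \<in> covectors M'" using U(1) V(1) by (simp_all add: line_def)
  show ?thesis
    by (rule corank_two_hyperplane[OF M' L rk gE gL UV(1) UL U(2,3) UV(2) VL V(2) h])
qed

text \<open>By \<open>line_vanish\<close> the zeros agree, so a disagreement at \<open>x\<close> is
  a pair of opposite signs. Eliminating \<open>x\<close> gives a covector vanishing at
  \<open>g\<close> and \<open>x\<close> but not at \<open>h\<close>, which forces
  \<open>U x = Zero\<close>.\<close>

lemma line_unique:
  assumes U: "line U" "U g = Zero" and V: "line V" "V g = Zero"
    and g: "X g \<noteq> Zero \<or> Y g \<noteq> Zero" and h: "U h = V h" "U h \<noteq> Zero"
  shows "U = V"
proof (rule ccontr)
  assume "U \<noteq> V"
  then obtain x where x: "U x \<noteq> V x" by auto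
  have Vh: "V h \<noteq> Zero" using h by simp
  have "U x \<noteq> Zero" "V x \<noteq> Zero"
    using x line_vanish[OF U h(2) V g, of x] line_vanish[OF V Vh U g, of x] by auto
  then have "U x = - V x" using x by (cases "U x"; cases "V x") auto
  then obtain Q where Q: "line Q" "Q x = Zero" "\<forall>h. V h = Zero \<longrightarrow> Q h = U h"
    "\<forall>h. U h = V h \<longrightarrow> Q h = U h"
    using line_eliminate[OF U(1) V(1) _ \<open>U x \<noteq> Zero\<close>] by metis
  have "Q h \<noteq> Zero" "Q g = Zero" using Q(3,4) h U V by simp_all
  then have "U x = Zero" using line_vanish[OF Q(1) _ _ U g Q(2)] by blast
  then show False using \<open>U x \<noteq> Zero\<close> by simp
qed

text \<open>A covector of \<open>M\<close> below \<open>V\<close> lifts to the line and vanishes at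
  \<open>g\<close>, so its zeros are zeros of \<open>V\<close>; this is minimality. The extended
  cocircuit with value \<open>\<sigma>\<close> at \<open>p\<close> also lies on the line, vanishes
  at \<open>g\<close> and agrees with \<open>V\<close> at \<open>h\<close>, so it equals
  \<open>V\<close>.\<close>

lemma line_cocircuit:
  assumes V: "line V" "V g = Zero" "V h \<noteq> Zero" and g: "X g \<noteq> Zero \<or> Y g \<noteq> Zero"
    and ne: "g \<noteq> p" "h \<noteq> p"
  shows "V(p := Zero) \<in> cocircuits M" and "V p = \<sigma> (V(p := Zero))"
proof -
  let ?V = "V(p := Zero)"
  have Vc: "?V \<in> covectors M" using V(1) by (simp add: M_covectors line_def)
  have "?V h \<noteq> Zero" using V(3) ne by simp
  then have nz: "?V \<noteq> (\<lambda>_. Zero)" by metis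
  have "U = ?V" if U: "U \<in> covectors M" "U \<noteq> (\<lambda>_. Zero)" "sv_le U ?V" for U
  proof -
    obtain U' where U': "U' \<in> covectors M'" "U = U'(p := Zero)" using U(1) M_covectors by auto
    have le: "U s = Zero \<or> U s = ?V s" for s using U(3) by (simp add: sv_le_def)
    obtain x where x: "U x \<noteq> Zero" using U(2) by auto
    have "line U'" unfolding line_def
    proof (intro conjI allI impI U'(1))
      fix s assume s: "X s = Zero \<and> Y s = Zero"
      then have "V s = Zero" "s \<noteq> p" using V(1) Xp by (auto simp: line_def)
      then show "U' s = Zero" using le[of s] U'(2) by auto
    qed
    moreover have "U' g = Zero" using le[of g] V(2) U'(2) ne(1) by auto
    moreover have "U' x \<noteq> Zero" using x U'(2) by (auto split: if_splits)
    ultimately have same: "V s = Zero" if "U' s = Zero" for s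
      using line_vanish[of U' g x V s] V(1,2) g that by blast
    have "U s = ?V s" for s
    proof (cases "s = p")
      case False
      then show ?thesis using same[of s] le[of s] U'(2) by auto
    qed (simp add: U'(2))
    then show ?thesis by blast
  qed
  then show co: "?V \<in> cocircuits M" using Vc nz by (simp add: cocircuits_def)
  let ?W = "?V(p := \<sigma> ?V)"
  have "\<forall>Y\<in>cocircuits M. Y(p := \<sigma> Y) \<in> cocircuits M'"
    using ext unfolding extension_with_localization_def by blast
  then have "?W \<in> cocircuits M'" using co by (rule bspec)
  then have W: "?W \<in> covectors M'" unfolding cocircuits_def by blast
  have "?W s = Zero" if "X s = Zero \<and> Y s = Zero" for s
  proof -
    have "s \<noteq> p" using that Xp by auto
    then show ?thesis using V(1) that by (simp add: line_def)
  qed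
  then have "line ?W" unfolding line_def using W by blast
  moreover have "?W g = Zero" "V h = ?W h" using V(2) ne by simp_all
  ultimately have "V = ?W" by (intro line_unique[OF V(1,2) _ _ g _ V(3)])
  from fun_cong[OF this, of p] show "V p = \<sigma> ?V" by simp
qed

section \<open>Restriction of an edge to the base matroid\<close>

abbreviation X\<^sub>0 where "X\<^sub>0 \<equiv> X(p := Zero)"
abbreviation Y\<^sub>0 where "Y\<^sub>0 \<equiv> Y(p := Zero)"

lemma restrict_X: "X\<^sub>0 \<in> cocircuits M" "\<sigma> X\<^sub>0 = Pos"
  and restrict_Y: "Y\<^sub>0 \<in> cocircuits M" "\<sigma> Y\<^sub>0 = Pos"
proof -
  obtain x where x: "X x \<noteq> Zero" "Y x = Zero" "x \<noteq> p" using only_X by blast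
  obtain y where y: "Y y \<noteq> Zero" "X y = Zero" "y \<noteq> p" using only_Y by blast
  show "X\<^sub>0 \<in> cocircuits M" "\<sigma> X\<^sub>0 = Pos" using line_cocircuit[OF line_X y(2) x(1)] x y Xp by auto
  show "Y\<^sub>0 \<in> cocircuits M" "\<sigma> Y\<^sub>0 = Pos" using line_cocircuit[OF line_Y x(2) y(1)] x y Yp by auto
qed

lemma restrict_conformal: "conformal X\<^sub>0 Y\<^sub>0"
  using conf by (auto simp: conformal_def sep_def)

text \<open>The common zero set avoids \<open>p\<close>, so deleting \<open>p\<close> does not
  change its rank; the total rank is preserved by the definition of an extension.\<close>

lemma restrict_comodular: "comodular M X\<^sub>0 Y\<^sub>0"
proof -
  let ?L = "zero_set M' (compose X Y)"
  have L: "zero_set M (compose X\<^sub>0 Y\<^sub>0) = ?L"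
    using Xp p_notin by (auto simp: zero_set_def compose_def M'_ground)
  have Lp: "?L \<subseteq> ground M' - {p}" using Xp by (auto simp: zero_set_def compose_def)
  have "rk M ?L = rk M' ?L"
    using rk_delete[OF M', of p ?L] M Lp by (simp add: M_delete[symmetric])
  moreover have "om_rank M' = om_rank M" using ext by (simp add: extension_with_localization_def)
  moreover have "rk M' ?L + 2 = om_rank M'" using comod by (simp add: comodular_def)
  moreover have "flat M (zero_set M (compose X\<^sub>0 Y\<^sub>0))"
    using om_compose[OF M] restrict_X restrict_Y unfolding flat_def cocircuits_def by blast
  moreover obtain h where h: "X h \<noteq> Zero" "Y h = Zero" "h \<noteq> p" using only_X by blast
  have "X\<^sub>0 h \<noteq> Y\<^sub>0 h" "X\<^sub>0 h \<noteq> (- Y\<^sub>0) h" using h by simp_all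
  then have "X\<^sub>0 \<noteq> Y\<^sub>0" "X\<^sub>0 \<noteq> - Y\<^sub>0" by metis+
  ultimately show ?thesis using restrict_X restrict_Y by (simp add: comodular_def L)
qed

end

section \<open>Edges of a lexicographic extension\<close>

lemma lex_localization_first:
  assumes "m < length es" "\<forall>a\<in>set (take m es). Y a = Zero" "Y (es ! m) \<noteq> Zero"
  shows "lex_localization es Y = Y (es ! m)"
proof -
  have "Y (es ! j) = Zero" if "j < m" for j
    using bspec[OF assms(2), of "es ! j"] assms(1) that nth_mem[of j "take m es"] by simp
  then have "find (\<lambda>e. Y e \<noteq> Zero) es = Some (es ! m)"
    using assms by (auto simp: find_Some_iff)
  then show ?thesis by (simp add: lex_localization_def)
qed

lemma lex_localization_zero: "\<forall>a\<in>set es. Y a = Zero \<Longrightarrow> lex_localization es Y = Zero"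
proof -
  assume "\<forall>a\<in>set es. Y a = Zero"
  then have "find (\<lambda>e. Y e \<noteq> Zero) es = None" by (auto simp: find_None_iff)
  then show ?thesis by (simp add: lex_localization_def)
qed

text \<open>Here \<open>e\<close> is the first listed element not vanishing at both endpoints;
  \<open>m\<close> counts from 0, so \<open>take m es\<close> lists the elements before it.
  \<open>Z\<close> is the point \<open>p = 0\<close> whose sign at \<open>f\<close> directs the
  edge.\<close>

locale lex_edge = extension_edge M M' p "lex_localization es" X Y
  for M M' :: "'a om" and p :: 'a and es :: "'a list" and X Y :: "'a sign_vector" +
  fixes m :: nat and e :: 'a and Z :: "'a sign_vector"
  assumes m: "m < length es" and e_def: "e = es ! m" and es: "set es \<subseteq> ground M"
    and zeroX: "\<forall>a\<in>set (take m es). X a = Zero" and zeroY: "\<forall>a\<in>set (take m es). Y a = Zero"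
    and e_line: "X e \<noteq> Zero \<or> Y e \<noteq> Zero"
    and Z: "elimination M' (- X) Y p Z"
begin

lemma e_ground: "e \<in> ground M" and e_ne_p: "e \<noteq> p"
proof -
  show "e \<in> ground M" using es nth_mem[OF m] by (auto simp: e_def)
  then show "e \<noteq> p" using p_notin by blast
qed

lemma Zp: "Z p = Zero" and Z_off: "h \<notin> sep (- X) Y \<Longrightarrow> Z h = compose (- X) Y h"
  using Z by (auto simp: elimination_def)

lemma Z_X: "Y h = Zero \<Longrightarrow> Z h = - X h" and Z_Y: "X h = Zero \<Longrightarrow> Z h = Y h"
  using Z_off[of h] compose_off_sep_left[of Y h "- X"] compose_off_sep_right[of "- X" h Y] by simp_all

lemma line_Z: "line Z"
  using Z Z_Y by (simp add: line_def elimination_def cocircuits_def)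

lemma line_take: "line V \<Longrightarrow> \<forall>a\<in>set (take m es). V a = Zero"
  using zeroX zeroY by (simp add: line_def)

text \<open>All of \<open>take m es\<close> vanishes on the line, so \<open>e\<close> is the first
  element at which the localization finds a nonzero sign.\<close>

lemma lex_sign:
  assumes V: "line V" "V g = Zero" "V e \<noteq> Zero" and g: "X g \<noteq> Zero \<or> Y g \<noteq> Zero" "g \<noteq> p"
  shows "V p = V e"
proof -
  let ?V = "V(p := Zero)"
  have "V p = lex_localization es ?V" by (rule line_cocircuit(2)[OF V g e_ne_p])
  also have "\<dots> = ?V (es ! m)"
  proof (rule lex_localization_first[OF m])
    show "\<forall>a\<in>set (take m es). ?V a = Zero" using line_take[OF V(1)] by simp
    show "?V (es ! m) \<noteq> Zero" using V(3) e_ne_p by (simp add: e_def[symmetric])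
  qed
  finally show ?thesis using e_ne_p by (simp add: e_def[symmetric])
qed

context
  fixes W h
  assumes W: "line W" "W e = Zero" and h: "h \<noteq> p" "W h = Z h" "Z h \<noteq> Zero"
begin

text \<open>Off the hyperplane \<open>e = 0\<close> every cocircuit of \<open>M\<close> on the line has \<open>p = e\<close>. Hence no element of
  the ground set of \<open>M\<close> changes sign strictly between \<open>W\<close> and \<open>Z\<close>.\<close>

lemma near_eq: "W p = Zero \<Longrightarrow> Z = W"
  using line_unique[OF line_Z Zp W(1), of h] h Xp by simp

text \<open>Eliminating \<open>h\<close> between \<open>W\<close> and \<open>- Z\<close> gives a
  point with \<open>p\<close> from \<open>W\<close> and \<open>e\<close> from \<open>- Z\<close>;
  \<open>lex_sign\<close> equates the two. If \<open>Z e\<close> were zero, \<open>Z\<close> would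
  equal \<open>W\<close>.\<close>

lemma near_sign: assumes Wp: "W p \<noteq> Zero" shows "Z e = - W p" "Z e \<noteq> Zero"
proof -
  have hl: "X h \<noteq> Zero \<or> Y h \<noteq> Zero" using line_supp[OF line_Z h(3)] .
  have Wh: "W h \<noteq> Zero" using h by simp
  show "Z e \<noteq> Zero"
  proof
    assume "Z e = Zero"
    then have "W = Z" using line_unique[OF W line_Z _ e_line h(2) Wh] by blast
    then show False using Wp Zp by simp
  qed
  have "W h = - (- Z) h" using h(2) by simp
  then obtain V where V: "line V" "V h = Zero" "\<forall>h. (- Z) h = Zero \<longrightarrow> V h = W h"
    "\<forall>h. W h = Zero \<longrightarrow> V h = (- Z) h"
    using line_eliminate[OF W(1) line_neg[OF line_Z] _ Wh] by metis
  have Ve: "V e = - Z e" using V(4) W(2) by simp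
  have "V p = W p" using V(3) Zp by simp
  moreover have "V p = V e" using lex_sign[OF V(1,2) _ hl h(1)] Ve \<open>Z e \<noteq> Zero\<close> by simp
  ultimately show "Z e = - W p" using Ve sign_neg_neg[of "Z e"] by simp
qed

text \<open>Otherwise \<open>f\<close> vanishes at \<open>Z\<close>, or at a point \<open>V\<close>
  with \<open>p\<close> from \<open>W\<close> and \<open>e\<close> from \<open>Z\<close>. There
  \<open>lex_sign\<close> gives \<open>Z p = Z e\<close> or \<open>W p = Z e\<close>, against
  \<open>near_sign\<close>.\<close>

lemma near_nonzero:
  assumes f: "f \<noteq> p" "W f \<noteq> Zero"
  shows "Z f = W f"
proof (cases "W p = Zero")
  case True then show ?thesis using near_eq by simp
next
  case False
  have fl: "X f \<noteq> Zero \<or> Y f \<noteq> Zero" using line_supp[OF W(1) f(2)] .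
  note t = near_sign[OF False]
  show ?thesis
  proof (rule ccontr)
    assume ne: "Z f \<noteq> W f"
    show False
    proof (cases "Z f = Zero")
      case True
      then have "Z p = Z e" using lex_sign[OF line_Z _ t(2) fl f(1)] by blast
      then show False using Zp t by simp
    next
      case nz: False
      then have "W f = - Z f" using ne f(2) by (cases "W f"; cases "Z f") auto
      then obtain V where V: "line V" "V f = Zero" "\<forall>h. Z h = Zero \<longrightarrow> V h = W h"
        "\<forall>h. W h = Zero \<longrightarrow> V h = Z h"
        using line_eliminate[OF W(1) line_Z _ f(2)] by metis
      have "V e = Z e" "V p = W p" using V(3,4) W(2) Zp by simp_all
      moreover have "V p = V e" using lex_sign[OF V(1,2) _ fl f(1)] t(2) \<open>V e = Z e\<close> by simp
      ultimately show False using t False by (cases "W p") auto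
    qed
  qed
qed

text \<open>Since \<open>W\<close> vanishes at both \<open>e\<close> and \<open>f\<close>, these are
  parallel on the line, and \<open>X\<close> gives their relative sign. The value follows from
  \<open>Z e = - W p\<close>.\<close>

lemma near_zero:
  assumes f: "f \<noteq> p" "W f = Zero" "X f \<noteq> Zero" and Xe: "X e = Pos" and Wp: "W p \<noteq> Zero"
  shows "Z f = (if W p = Pos then - X f else X f)"
proof (rule ccontr)
  assume ne: "Z f \<noteq> (if W p = Pos then - X f else X f)"
  have fl: "X f \<noteq> Zero \<or> Y f \<noteq> Zero" using f by simp
  note t = near_sign[OF Wp]
  have "Z f \<noteq> Zero"
  proof
    assume "Z f = Zero"
    then have "Z p = Z e" using lex_sign[OF line_Z _ t(2) fl f(1)] by blast
    then show False using Zp t by simp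
  qed
  \<comment> \<open>One of \<open>Z\<close>, \<open>- Z\<close> is positive at \<open>e\<close> and
    opposite to \<open>X\<close> at \<open>f\<close>; eliminating \<open>f\<close> against
    \<open>X\<close> yields a zero of \<open>f\<close> that is not a zero of
    \<open>e\<close>.\<close>
  then obtain Q where Q: "line Q" "Q e = Pos" "X f = - Q f"
  proof (cases "W p = Pos")
    case True
    then have "(- Z) e = Pos" "X f = - (- Z) f"
      using t ne f(3) \<open>Z f \<noteq> Zero\<close> by (cases "Z f"; cases "X f"; simp)+
    then show thesis using that[OF line_neg[OF line_Z]] by blast
  next
    case False
    then have "W p = Neg" using Wp by (cases "W p") auto
    then have "Z e = Pos" "X f = - Z f"
      using t ne f(3) \<open>Z f \<noteq> Zero\<close> by (cases "Z f"; cases "X f"; simp)+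
    then show thesis using that[OF line_Z] by blast
  qed
  obtain V where V: "line V" "V f = Zero" "\<forall>h. X h = Q h \<longrightarrow> V h = X h"
    using line_eliminate[OF line_X Q(1,3) f(3)] by metis
  have Ve: "V e \<noteq> Zero" using V(3) Q(2) Xe by simp
  have Wh: "W h \<noteq> Zero" using h by simp
  have "V e = Zero" by (rule line_vanish[OF W(1) f(2) Wh V(1,2) fl W(2)])
  then show False using Ve by simp
qed

end

text \<open>\<open>near_nonzero\<close> with \<open>W = Y\<close>: this is the point
  \<open>e = 0\<close>, and \<open>Z\<close> agrees with \<open>Y\<close> where \<open>X\<close>
  vanishes.\<close>

lemma descending_edge:
  assumes "Y e = Zero" "Y f \<noteq> Zero" "f \<noteq> p" shows "Z f = Y f"
proof -
  obtain h where h: "Y h \<noteq> Zero" "X h = Zero" "h \<noteq> p" using only_Y by blast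
  show ?thesis using near_nonzero[OF line_Y assms(1) h(3), of f] Z_Y[OF h(2)] h assms by simp
qed

text \<open>\<open>near_nonzero\<close> with \<open>W = - X\<close>, with which \<open>Z\<close>
  agrees where \<open>Y\<close> vanishes.\<close>

lemma ascending_edge:
  assumes "X e = Zero" "X f \<noteq> Zero" "f \<noteq> p" shows "Z f = - X f"
proof -
  obtain h where h: "X h \<noteq> Zero" "Y h = Zero" "h \<noteq> p" using only_X by blast
  show ?thesis using near_nonzero[OF line_neg[OF line_X] _ h(3), of f] Z_X[OF h(2)] h assms by simp
qed

text \<open>\<open>W\<close> directs the edge when \<open>e\<close> replaces \<open>p\<close>, and
  the clauses compare it with \<open>Z\<close>. In the last clause, the common zero set together
  with \<open>e\<close> has rank below \<open>om_rank M\<close>, so \<open>f\<close> in general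
  position is outside its closure.\<close>

lemma level_edge:
  assumes XYe: "X e = Pos" "Y e = Pos" and f: "f \<noteq> p" "f \<in> ground M"
  shows "\<exists>W. elimination M (- X\<^sub>0) Y\<^sub>0 e W \<and> (\<forall>a\<in>set (take m es). W a = Zero) \<and>
    (W f \<noteq> Zero \<or> lex_localization es W = Zero \<longrightarrow> Z f = W f) \<and>
    (W f = Zero \<and> X f \<noteq> Zero \<and> lex_localization es W \<noteq> Zero \<longrightarrow>
       Z f = (if lex_localization es W = Pos then - X f else X f)) \<and>
    (general_position M f \<and> f \<noteq> e \<and> X f \<noteq> Zero \<longrightarrow> W f \<noteq> Zero)"
proof -
  have cov: "- X \<in> covectors M'" "Y \<in> covectors M'"
    using line_neg[OF line_X] line_Y by (simp_all add: line_def)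
  have "e \<in> sep (- X) Y" using XYe by (simp add: sep_def)
  then obtain W where W: "W \<in> covectors M'" "W e = Zero"
    "\<forall>h. h \<notin> sep (- X) Y \<longrightarrow> W h = compose (- X) Y h"
    using om_eliminate[OF M' cov] by blast
  have lW: "line W" unfolding line_def using W(1,3) by (simp add: sep_def compose_def)
  obtain h where h: "X h \<noteq> Zero" "Y h = Zero" "h \<noteq> p" using only_X by blast
  have Zh: "Z h \<noteq> Zero" using Z_X[OF h(2)] h(1) by simp
  \<comment> \<open>Both eliminate between \<open>- X\<close> and \<open>Y\<close>, so both take the
    value of \<open>- X\<close> where \<open>Y\<close> vanishes.\<close>
  have Wh: "W h = Z h"
    using W(3) Z_X[OF h(2)] compose_off_sep_left[of Y h "- X"] h(2) by simp
  let ?W = "W(p := Zero)"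
  have co: "?W \<in> cocircuits M" and Wp: "W p = lex_localization es ?W"
    using line_cocircuit[OF lW W(2) _ e_line e_ne_p h(3)] Wh Zh by simp_all
  have "elimination M (- X\<^sub>0) Y\<^sub>0 e ?W"
    unfolding elimination_def
  proof (intro conjI allI impI)
    show "e \<in> sep (- X\<^sub>0) Y\<^sub>0" using XYe e_ne_p by (simp add: sep_def)
    show "?W \<in> cocircuits M" "?W e = Zero" using co W(2) by simp_all
    show "supp ?W \<subseteq> supp (compose (- X\<^sub>0) Y\<^sub>0) - {e}"
      using lW W(2) by (auto simp: supp_def compose_def line_def)
    fix h assume "h \<notin> sep (- X\<^sub>0) Y\<^sub>0"
    then show "?W h = compose (- X\<^sub>0) Y\<^sub>0 h"
      using W(3) by (cases "h = p") (simp_all add: sep_def compose_def)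
  qed
  moreover have "\<forall>a\<in>set (take m es). ?W a = Zero" using line_take[OF lW] by simp
  moreover have "W f \<noteq> Zero \<or> W p = Zero \<longrightarrow> Z f = W f"
    using near_nonzero[OF lW W(2) h(3) Wh Zh f(1)] near_eq[OF lW W(2) h(3) Wh Zh] by auto
  moreover have "W f = Zero \<and> X f \<noteq> Zero \<and> W p \<noteq> Zero \<longrightarrow>
       Z f = (if W p = Pos then - X f else X f)"
    using near_zero[OF lW W(2) h(3) Wh Zh f(1)] XYe(1) by blast
  moreover have "W f \<noteq> Zero" if gp: "general_position M f" "f \<noteq> e" "X f \<noteq> Zero"
  proof
    assume Wf: "W f = Zero"
    let ?L = "zero_set M (compose X\<^sub>0 Y\<^sub>0)"
    have L: "?L \<subseteq> ground M" by (auto simp: zero_set_def)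
    have fL: "f \<notin> ?L" using gp(3) f(1) by (simp add: zero_set_def compose_def)
    have "rk M (insert e ?L) \<le> rk M ?L + 1" by (rule rk_insert_le[OF M L e_ground])
    moreover have "rk M ?L + 2 = om_rank M" using restrict_comodular by (simp add: comodular_def)
    ultimately have "rk M (insert e ?L) < om_rank M" by simp
    moreover have "insert e ?L \<subseteq> ground M - {f}" using L fL gp(2) e_ground by auto
    ultimately have "f \<notin> cl M (insert e ?L)" using gp(1) unfolding general_position_def by blast
    moreover have "insert e ?L \<subseteq> ground M" using L e_ground by simp
    ultimately obtain V where V: "V \<in> covectors M" "\<forall>s\<in>insert e ?L. V s = Zero" "V f \<noteq> Zero"
      using not_in_clE[OF M _ f(2)] by blast
    obtain V' where V': "V' \<in> covectors M'" "V = V'(p := Zero)" using V(1) M_covectors by auto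
    have "V' s = Zero" if s: "X s = Zero \<and> Y s = Zero" for s
    proof -
      have sp: "s \<noteq> p" using s Xp by auto
      have "s \<in> ?L \<or> s \<notin> ground M" using s sp by (simp add: zero_set_def compose_def)
      then have "V s = Zero" using V(2) om_supp[OF M V(1)] by blast
      then show ?thesis using V'(2) sp by simp
    qed
    then have "line V'" using V'(1) by (simp add: line_def)
    moreover have "V' e = Zero" using V(2) V'(2) e_ne_p by simp
    ultimately have "V' f = Zero" using line_vanish[OF lW W(2) _ _ _ e_line Wf] Wh Zh by metis
    then show False using V(3) V'(2) by (simp split: if_splits)
  qed
  ultimately show ?thesis using f(1) by (intro exI[of _ ?W]) (simp add: Wp[symmetric])
qed

end

section \<open>Directed cycles\<close>

lemma cyclic_mono_constant:
  fixes \<phi> :: "nat \<Rightarrow> int"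
  assumes mono: "\<And>i. i < n \<Longrightarrow> \<phi> i \<le> \<phi> (Suc i mod n)" and "i < n" "j < n"
  shows "\<phi> i = \<phi> j"
proof -
  have up: "\<phi> a \<le> \<phi> (a + d)" if "a + d < n" for a d
    using that
  proof (induction d)
    case (Suc d)
    then show ?case using mono[of "a + d"] by simp
  qed simp
  have "\<phi> x = \<phi> 0" if x: "x < n" for x
  proof (rule antisym)
    show "\<phi> 0 \<le> \<phi> x" using up[of 0 x] x by simp
    have "\<phi> x \<le> \<phi> (n - 1)" using up[of x "n - 1 - x"] x by simp
    also have "\<dots> \<le> \<phi> 0" using mono[of "n - 1"] x by simp
    finally show "\<phi> x \<le> \<phi> 0" .
  qed
  from this[OF \<open>i < n\<close>] this[OF \<open>j < n\<close>] show ?thesis by simp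
qed

text \<open>A positive value would make \<open>Ys\<close> a directed cycle: positive edges are
  forward and the others undirected.\<close>

lemma euclidean_cycle_zero:
  assumes eu: "euclidean_program N g q" and "distinct Ys"
    and edge: "\<And>i. i < length Ys \<Longrightarrow> program_edge N g (Ys ! i) (Ys ! (Suc i mod length Ys))"
    and elim: "\<And>i. i < length Ys \<Longrightarrow> elimination N (- (Ys ! i)) (Ys ! (Suc i mod length Ys)) g (W i)"
    and sign: "\<And>i. i < length Ys \<Longrightarrow> W i q \<noteq> Neg" and i: "i < length Ys"
  shows "W i q = Zero"
proof (rule ccontr)
  assume "W i q \<noteq> Zero"
  then have "W i q = Pos" using sign[OF i] by (cases "W i q") auto
  then have "forward_edge N g q (Ys ! i) (Ys ! (Suc i mod length Ys))"
    using edge[OF i] elim[OF i] unfolding forward_edge_def by blast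
  moreover have "forward_edge N g q (Ys ! j) (Ys ! (Suc j mod length Ys)) \<or>
      undirected_edge N g q (Ys ! j) (Ys ! (Suc j mod length Ys))" if j: "j < length Ys" for j
  proof -
    have "W j q = Pos \<or> W j q = Zero" using sign[OF j] by (cases "W j q") auto
    then show ?thesis
      using edge[OF j] elim[OF j] unfolding forward_edge_def undirected_edge_def by blast
  qed
  moreover have "set Ys \<subseteq> program_vertices N g"
  proof
    fix Y assume "Y \<in> set Ys"
    then obtain j where "j < length Ys" "Y = Ys ! j" by (auto simp: in_set_conv_nth)
    then show "Y \<in> program_vertices N g" using edge[of j] by (simp add: program_edge_def)
  qed
  ultimately have "directed_cycle N g q Ys" using assms(2) i unfolding directed_cycle_def by blast
  then show False using eu by (auto simp: euclidean_program_def)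
qed

section \<open>Reversal of edges and cycles\<close>

lemma zero_set_compose_commute: "zero_set N (compose X Y) = zero_set N (compose Y X)"
  by (auto simp: zero_set_def compose_def split: if_splits)

lemma program_edge_sym: "program_edge N g X Y \<Longrightarrow> program_edge N g Y X"
  unfolding program_edge_def comodular_def zero_set_compose_commute[of N X Y]
  by (metis conformal_sym sv_neg_neg)

text \<open>Both separation sets consist of the elements where \<open>X\<close> and \<open>Y\<close>
  agree and are nonzero; elsewhere the two compositions are negatives of each other.\<close>

lemma elimination_reverse:
  assumes N: "oriented_matroid N" and W: "elimination N (- X) Y g W"
  shows "elimination N (- Y) X g (- W)"
  unfolding elimination_def
proof (intro conjI allI impI)
  have sep: "sep (- Y) X = sep (- X) Y"
  proof -
    have "h \<in> sep (- Y) X \<longleftrightarrow> h \<in> sep (- X) Y" for h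
      by (cases "X h"; cases "Y h") (simp_all add: sep_def)
    then show ?thesis by blast
  qed
  show "g \<in> sep (- Y) X" using W by (simp add: sep elimination_def)
  show "- W \<in> cocircuits N" using W cocircuit_neg[OF N] by (simp add: elimination_def)
  show "(- W) g = Zero" using W by (simp add: elimination_def)
  have "supp W \<subseteq> supp (compose (- X) Y) - {g}" using W by (simp add: elimination_def)
  then show "supp (- W) \<subseteq> supp (compose (- Y) X) - {g}"
    by (auto simp: supp_def compose_def split: if_splits)
  fix h assume h: "h \<notin> sep (- Y) X"
  then have "W h = compose (- X) Y h" using W by (simp add: sep elimination_def)
  then show "(- W) h = compose (- Y) X h"
    using h by (cases "X h"; cases "Y h") (simp_all add: sep_def compose_def)
qed

lemma euclidean_cycle_zero_reverse:
  assumes eu: "euclidean_program N g q" and dist: "distinct Ys"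
    and edge: "\<And>i. i < length Ys \<Longrightarrow> program_edge N g (Ys ! i) (Ys ! (Suc i mod length Ys))"
    and elim: "\<And>i. i < length Ys \<Longrightarrow> elimination N (- (Ys ! i)) (Ys ! (Suc i mod length Ys)) g (W i)"
    and sign: "\<And>i. i < length Ys \<Longrightarrow> W i q \<noteq> Pos" and i: "i < length Ys"
  shows "W i q = Zero"
proof -
  let ?n = "length Ys"
  \<comment> \<open>The edge at position \<open>j\<close> of \<open>rev Ys\<close> is edge
    \<open>r j\<close> of \<open>Ys\<close> traversed backwards, with elimination
    \<open>- W (r j)\<close>. On the indices \<open>r\<close> is an involution.\<close>
  define r where "r i = ?n - 1 - (Suc i mod ?n)" for i
  have N: "oriented_matroid N" using eu by (simp add: euclidean_program_def om_program_def)
  have r: "r j < ?n" "Suc (r j) mod ?n = ?n - 1 - j" if j: "j < ?n" for j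
  proof -
    have "r j < ?n \<and> Suc (r j) mod ?n = ?n - 1 - j"
    proof (cases "Suc j = ?n")
      case True
      then have "r j = ?n - 1" "Suc (?n - 1) = ?n" "?n - 1 - j = 0" by (auto simp: r_def)
      then show ?thesis by simp
    next
      case False
      then have "Suc j < ?n" using j by simp
      then have "r j < ?n" "Suc (r j) = ?n - 1 - j" "?n - 1 - j < ?n" by (auto simp: r_def)
      then show ?thesis by simp
    qed
    then show "r j < ?n" "Suc (r j) mod ?n = ?n - 1 - j" by auto
  qed
  have nth: "rev Ys ! j = Ys ! (Suc (r j) mod ?n)" "rev Ys ! (Suc j mod ?n) = Ys ! r j"
    if j: "j < ?n" for j
  proof -
    have "Suc j mod ?n < ?n" using j by (intro mod_less_divisor) linarith
    then show "rev Ys ! (Suc j mod ?n) = Ys ! r j" by (simp add: rev_nth r_def)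
    show "rev Ys ! j = Ys ! (Suc (r j) mod ?n)" using j unfolding r(2)[OF j] by (simp add: rev_nth)
  qed
  have "(- W (r j)) q = Zero" if "j < ?n" for j
  proof (rule euclidean_cycle_zero[OF eu, of "rev Ys" "\<lambda>j. - W (r j)"])
    show "distinct (rev Ys)" using dist by simp
    fix j assume "j < length (rev Ys)"
    then have j: "j < ?n" by simp
    show "program_edge N g (rev Ys ! j) (rev Ys ! (Suc j mod length (rev Ys)))"
      using program_edge_sym[OF edge[OF r(1)[OF j]]] nth[OF j] by simp
    show "elimination N (- (rev Ys ! j)) (rev Ys ! (Suc j mod length (rev Ys))) g (- W (r j))"
      using elimination_reverse[OF N elim[OF r(1)[OF j]]] nth[OF j] by simp
    show "(- W (r j)) q \<noteq> Neg" using sign[OF r(1)[OF j]] by simp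
  qed (use that in simp)
  moreover have "r (r i) = i" unfolding r_def[of "r i"] r(2)[OF i] using i by simp
  ultimately show ?thesis using r(1)[OF i] by fastforce
qed

text \<open>Some cocircuit is nonzero at the first listed element, and the localization copies that
  sign, so \<open>p\<close> is not a loop. A coloop \<open>f\<close> of \<open>M'\<close> would give
  a cocircuit of \<open>M\<close> supported on \<open>f\<close> alone with localization zero, which
  \<open>col\<close> excludes.\<close>

lemma lexicographic_extension_program:
  assumes M: "oriented_matroid M" and lex: "lexicographic_extension M es p M'"
    and es: "es \<noteq> []" and ind: "independent M (set es)" and f: "f \<in> ground M"
    and col: "coloop M f \<Longrightarrow> f \<in> cl M {es ! 0}"
  shows "om_program M' p f"
proof -
  let ?\<sigma> = "lex_localization es"
  have M': "oriented_matroid M'" and p: "p \<notin> ground M" and gr: "ground M' = insert p (ground M)"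
    and del: "delete M' p = M" and rank: "om_rank M' = om_rank M"
    and loc: "\<forall>Y\<in>cocircuits M. Y(p := ?\<sigma> Y) \<in> cocircuits M'"
    using lex unfolding lexicographic_extension_def extension_with_localization_def by blast+
  have locc: "Y(p := ?\<sigma> Y) \<in> covectors M'" if "Y \<in> cocircuits M" for Y
    using loc that unfolding cocircuits_def[of M'] by blast
  have cov: "covectors M = (\<lambda>X. X(p := Zero)) ` covectors M'" using delete_simps(2)[of M' p] del by simp
  have pf: "p \<noteq> f" using p f by auto
  have e0: "es ! 0 \<in> set es" using es by simp
  then have e0M: "es ! 0 \<in> ground M" using ind by (auto simp: independent_def)
  have first: "?\<sigma> Y = Y (es ! 0)" if "Y (es ! 0) \<noteq> Zero" for Y
    using lex_localization_first[of 0 es Y] es that by simp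
  have "\<not> loop M' p"
  proof -
    have "es ! 0 \<notin> cl M (set es - {es ! 0})" using ind e0 by (simp add: independent_def)
    moreover have "set es - {es ! 0} \<subseteq> ground M" using ind by (auto simp: independent_def)
    ultimately obtain V where "V \<in> covectors M" "V (es ! 0) \<noteq> Zero" using not_in_clE[OF M _ e0M] by blast
    then obtain Y where Y: "Y \<in> cocircuits M" "Y (es ! 0) \<noteq> Zero" using cocircuit_support_exists[OF M] by blast
    have "(Y(p := ?\<sigma> Y)) p \<noteq> Zero" using first[of Y] Y(2) by simp
    then have "p \<notin> cl M' {}" by (intro not_in_clI[OF M' _ locc[OF Y(1)]]) simp_all
    then show ?thesis by (simp add: loop_def)
  qed
  moreover have "\<not> coloop M' f"
  proof
    assume "coloop M' f"
    then have "f \<notin> cl M' (ground M' - {f})" "f \<in> ground M'" by (simp_all add: coloop_def)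
    then obtain V where V: "V \<in> covectors M'" "\<forall>s\<in>ground M' - {f}. V s = Zero" "V f \<noteq> Zero"
      using not_in_clE[OF M' Diff_subset] by blast
    have V0: "V s = Zero" if "s \<noteq> f" for s using V(2) om_supp[OF M' V(1), of s] that by blast
    have "V(p := Zero) = V" using V0[OF pf] by auto
    then have VM: "V \<in> covectors M" using cov V(1) by (metis image_eqI)
    have "U = V" if U: "U \<noteq> (\<lambda>_. Zero)" "sv_le U V" for U
    proof -
      have le: "U s = Zero \<or> U s = V s" for s using U(2) by (simp add: sv_le_def)
      obtain x where x: "U x \<noteq> Zero" using U(1) by auto
      then have "x = f" using le[of x] V0[of x] by auto
      then have "U f = V f" using le[of f] x by auto
      then have "U s = V s" for s using le[of s] V0[of s] by (cases "s = f") auto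
      then show ?thesis by blast
    qed
    moreover have "V \<noteq> (\<lambda>_. Zero)" using V(3) by auto
    ultimately have Vco: "V \<in> cocircuits M" using VM by (simp add: cocircuits_def)
    \<comment> \<open>Otherwise eliminating \<open>f\<close> leaves a covector nonzero only at
      \<open>p\<close>, and adding \<open>p\<close> to a basis of \<open>M\<close> exceeds the rank
      of \<open>M'\<close>.\<close>
    have "?\<sigma> V = Zero"
    proof (rule ccontr)
      assume nz: "?\<sigma> V \<noteq> Zero"
      let ?Y = "V(p := ?\<sigma> V)"
      have Yf: "?Y f = - (- V) f" "?Y f \<noteq> Zero" using pf V(3) by simp_all
      obtain Q where Q: "Q \<in> covectors M'" "Q f = Zero" "\<forall>h. (- V) h = Zero \<longrightarrow> Q h = ?Y h"
        using om_eliminate_cases[OF M' locc[OF Vco] om_neg[OF M' V(1)] Yf] by (elim bexE conjE)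
      have Qp: "Q p \<noteq> Zero" using Q(3) V0[OF pf] nz by simp
      have QM: "\<forall>s\<in>ground M. Q s = Zero"
      proof
        fix s assume "s \<in> ground M"
        then have "s \<noteq> p" using p by blast
        then show "Q s = Zero" using Q(2,3) V0[of s] by (cases "s = f") simp_all
      qed
      have gM: "ground M \<subseteq> ground M'" using gr by blast
      obtain B where B: "independent M' B" "B \<subseteq> ground M" "ground M \<subseteq> cl M' B"
        using basis_extension[OF M' gM independent_empty empty_subsetI] by metis
      have BE: "B \<subseteq> ground M'" using B(2) gM by blast
      have "p \<notin> cl M' B" by (rule not_in_clI[OF M' BE Q(1) _ Qp]) (use QM B(2) in blast)
      then have ip: "independent M' (insert p B)" using independent_insert[OF M' B(1)] gr by simp
      obtain C where C: "independent M' C" "C \<subseteq> ground M'" "ground M' \<subseteq> cl M' C"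
        using basis_extension[OF M' order_refl independent_empty empty_subsetI] by metis
      have "card (insert p B) \<le> card C"
        using BE gr by (intro independent_card_le[OF M' ip C(2)] order_trans[OF _ C(3)]) simp
      moreover have "card (insert p B) = card B + 1"
      proof -
        have "finite B" using BE om_finite[OF M'] by (auto intro: finite_subset)
        moreover have "p \<notin> B" using B(2) p by blast
        ultimately show ?thesis by simp
      qed
      moreover have "card C = om_rank M'"
        using rk_eq_card_basis[OF M' order_refl C] by (simp add: om_rank_def)
      moreover have "card B = om_rank M"
        using rk_eq_card_basis[OF M' gM B] rk_delete[OF M', of p "ground M"] del M gr p
        by (simp add: om_rank_def)
      ultimately show False using rank by simp
    qed
    then have "V (es ! 0) = Zero" using first[of V] by auto
    have "f \<notin> cl M (ground M - {f})"
      by (rule not_in_clI[OF M Diff_subset VM _ V(3)]) (use V0 in blast)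
    then have "f \<in> cl M {es ! 0}" using col f by (simp add: coloop_def)
    then have "V f = Zero" using in_clD[OF M, of "{es ! 0}" f V] VM e0M \<open>V (es ! 0) = Zero\<close> by simp
    then show False using V(3) by simp
  qed
  ultimately show ?thesis using M' pf gr f by (simp add: om_program_def)
qed

section \<open>Acyclicity of the extended program\<close>

lemma contract_empty: "contract M {} = M"
  by (simp add: contract_def)

primrec sign_int :: "sign \<Rightarrow> int" where
  "sign_int Zero = 0" | "sign_int Pos = 1" | "sign_int Neg = - 1"

lemma sign_int_inject: "sign_int a = sign_int b \<Longrightarrow> a = b"
  by (cases a; cases b) auto

text \<open>If the sign at \<open>f\<close> decreases, \<open>f\<close> is off the separation set
  and \<open>Z f\<close> is \<open>- X f\<close>, or \<open>Y f\<close> when \<open>X f\<close> is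
  zero; either way it is \<open>Neg\<close>.\<close>

lemma objective_sign_mono:
  assumes "elimination M (- X) Y g Z" "Z f \<noteq> Neg"
  shows "sign_int (X f) \<le> sign_int (Y f)"
proof -
  have "f \<notin> sep (- X) Y \<longrightarrow> Z f = compose (- X) Y f" using assms by (simp add: elimination_def)
  then show ?thesis using assms(2) by (cases "X f"; cases "Y f") (simp_all add: sep_def compose_def)
qed

text \<open>\<open>objective\<close> and \<open>tie\<close> restate (i) and (ii) with
  \<open>m\<close> counted from 0 and the bound by \<open>l\<close> expressed through closures. The
  first alternative in \<open>objective\<close> is the index at which \<open>f\<close> enters the
  closure.\<close>

lemma lexicographic_extension_acyclic:
  assumes M: "oriented_matroid M" and f: "f \<in> ground M"
    and ind: "independent M (set es)" and lex: "lexicographic_extension M es p M'"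
    and objective: "\<And>m. m < length es \<Longrightarrow> f \<notin> cl M (set (take m es)) \<Longrightarrow>
      f \<in> cl M (set (take (Suc m) es)) \<or> euclidean_program (contract M (set (take m es))) (es ! m) f"
    and tie: "\<And>m j. m < j \<Longrightarrow> j < length es \<Longrightarrow> f \<notin> cl M (set (take m es)) \<Longrightarrow>
      \<not> general_position M f \<or> f \<in> set es \<Longrightarrow>
      euclidean_program (contract M (set (take m es))) (es ! m) (es ! j)"
  shows "\<not> directed_cycle M' p f Xs"
proof
  assume cyc: "directed_cycle M' p f Xs"
  let ?\<sigma> = "lex_localization es"
  define n where "n = length Xs"
  define s where "s i = Suc i mod n" for i
  have dist: "distinct Xs"
    and vert: "set Xs \<subseteq> program_vertices M' p"
    and step: "\<And>i. i < n \<Longrightarrow> forward_edge M' p f (Xs ! i) (Xs ! s i) \<or> undirected_edge M' p f (Xs ! i) (Xs ! s i)"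
    and fwd: "\<exists>i<n. forward_edge M' p f (Xs ! i) (Xs ! s i)"
    using cyc unfolding directed_cycle_def n_def s_def by blast+
  have sn: "s i < n" if "i < n" for i using that unfolding s_def by (intro mod_less_divisor) linarith
  have "\<exists>Z. program_edge M' p (Xs ! i) (Xs ! s i) \<and> elimination M' (- (Xs ! i)) (Xs ! s i) p Z \<and>
      Z f \<noteq> Neg \<and> (forward_edge M' p f (Xs ! i) (Xs ! s i) \<longrightarrow> Z f = Pos)" if "i < n" for i
  proof (cases "forward_edge M' p f (Xs ! i) (Xs ! s i)")
    case True
    then obtain Z where "program_edge M' p (Xs ! i) (Xs ! s i)" "elimination M' (- (Xs ! i)) (Xs ! s i) p Z"
      "Z f = Pos" unfolding forward_edge_def by blast
    then show ?thesis by (intro exI[of _ Z]) simp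
  next
    case False
    then have "undirected_edge M' p f (Xs ! i) (Xs ! s i)" using step[OF that] by blast
    then obtain Z where "program_edge M' p (Xs ! i) (Xs ! s i)" "elimination M' (- (Xs ! i)) (Xs ! s i) p Z"
      "Z f = Zero" unfolding undirected_edge_def by blast
    then show ?thesis using False by (intro exI[of _ Z]) simp
  qed
  then obtain Z where edge: "\<And>i. i < n \<Longrightarrow> program_edge M' p (Xs ! i) (Xs ! s i)"
    and Z: "\<And>i. i < n \<Longrightarrow> elimination M' (- (Xs ! i)) (Xs ! s i) p (Z i)"
    and Zf: "\<And>i. i < n \<Longrightarrow> Z i f \<noteq> Neg"
    and Zpos: "\<And>i. i < n \<Longrightarrow> forward_edge M' p f (Xs ! i) (Xs ! s i) \<Longrightarrow> Z i f = Pos"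
    by metis
  obtain i\<^sub>0 where i0: "i\<^sub>0 < n" "Z i\<^sub>0 f = Pos" using fwd Zpos by blast

  have ext: "extension_with_localization M p ?\<sigma> M'" using lex by (simp add: lexicographic_extension_def)
  have p: "p \<notin> ground M" using ext by (simp add: extension_with_localization_def)
  have fp: "f \<noteq> p" using p f by blast
  have esM: "set es \<subseteq> ground M" using ind by (simp add: independent_def)
  have Xp: "(Xs ! i) p = Pos" if "i < n" for i
    using subsetD[OF vert nth_mem[of i Xs]] that by (simp add: n_def program_vertices_def)
  have ee: "extension_edge M M' p ?\<sigma> (Xs ! i) (Xs ! s i)" if "i < n" for i
    using M ext edge[OF that] Xp[OF that] Xp[OF sn[OF that]]
    by (simp add: extension_edge_def program_edge_def)

  define c where "c = (Xs ! i\<^sub>0) f"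
  have c: "(Xs ! i) f = c" if "i < n" for i
  proof -
    have "sign_int ((Xs ! i) f) = sign_int ((Xs ! i\<^sub>0) f)"
      by (rule cyclic_mono_constant[of n "\<lambda>i. sign_int ((Xs ! i) f)"])
        (use objective_sign_mono[OF Z Zf] that i0 in \<open>simp_all add: s_def\<close>)
    then show ?thesis unfolding c_def by (rule sign_int_inject)
  qed
  \<comment> \<open>If both ends of an edge vanish at \<open>f\<close>, so does its elimination; the
    forward edge \<open>i\<^sub>0\<close> excludes this.\<close>
  have c0: "c \<noteq> Zero"
  proof
    assume "c = Zero"
    then have "(Xs ! i\<^sub>0) f = Zero" "(Xs ! s i\<^sub>0) f = Zero" using c i0 sn by simp_all
    then have "Z i\<^sub>0 f = Zero" using Z[OF i0(1)] by (simp add: elimination_def sep_def compose_def)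
    then show False using i0 by simp
  qed

  define P where "P m \<longleftrightarrow> m < length es \<and> (\<exists>i<n. (Xs ! i) (es ! m) \<noteq> Zero)" for m
  have esp: "es ! m \<noteq> p" if "m < length es" for m using subsetD[OF esM nth_mem[OF that]] p by auto
  have "\<exists>m. P m"
  proof (rule ccontr)
    assume none: "\<nexists>m. P m"
    have "((Xs ! i\<^sub>0)(p := Zero)) a = Zero" if a: "a \<in> set es" for a
    proof -
      obtain m where "m < length es" "a = es ! m" using a by (auto simp: in_set_conv_nth)
      then show ?thesis using none i0 unfolding P_def by auto
    qed
    then have "?\<sigma> ((Xs ! i\<^sub>0)(p := Zero)) = Zero" by (intro lex_localization_zero ballI)
    then show False using extension_edge.restrict_X(2)[OF ee[OF i0(1)]] by simp
  qed
  define m where "m = (LEAST m. P m)"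
  have Pm: "P m" unfolding m_def by (rule LeastI_ex[OF \<open>\<exists>m. P m\<close>])
  have least: "\<not> P j" if "j < m" for j using that unfolding m_def by (rule not_less_Least)
  define A where "A = set (take m es)"
  define e where "e = es ! m"
  have m: "m < length es" using Pm by (simp add: P_def)
  have XA: "\<forall>a\<in>A. (Xs ! i) a = Zero" if "i < n" for i
  proof
    fix a assume "a \<in> A"
    then obtain j where "j < m" "a = es ! j" unfolding A_def using m by (auto simp: in_set_conv_nth)
    then show "(Xs ! i) a = Zero" using least[of j] that m unfolding P_def by auto
  qed
  have Xe: "(Xs ! i) e = Pos" if i: "i < n" "(Xs ! i) e \<noteq> Zero" for i
  proof -
    let ?X = "(Xs ! i)(p := Zero)"
    have ep: "e \<noteq> p" using esp[OF m] by (simp add: e_def)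
    have "?\<sigma> ?X = ?X (es ! m)"
    proof (rule lex_localization_first[OF m])
      show "\<forall>a\<in>set (take m es). ?X a = Zero" using XA[OF i(1)] by (simp add: A_def)
      show "?X (es ! m) \<noteq> Zero" using i(2) ep by (simp add: e_def)
    qed
    then show ?thesis using extension_edge.restrict_X(2)[OF ee[OF i(1)]] ep by (simp add: e_def)
  qed
  have le: "lex_edge M M' p es (Xs ! i) (Xs ! s i) m e (Z i)"
    if "i < n" "(Xs ! i) e \<noteq> Zero \<or> (Xs ! s i) e \<noteq> Zero" for i
    using ee[OF that(1)] m esM XA[OF that(1)] XA[OF sn[OF that(1)]] that(2) Z[OF that(1)]
    by (simp add: lex_edge_def lex_edge_axioms_def e_def A_def)

  \<comment> \<open>Entering or leaving the hyperplane \<open>e = 0\<close> forces the direction of the edge to be given by \<open>c\<close>,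
    with opposite signs, so a cycle with constant \<open>c\<close> cannot cross it.\<close>
  have all_pos: "(Xs ! i) e = Pos" if i: "i < n" for i
  proof -
    obtain i1 where i1: "i1 < n" "(Xs ! i1) e \<noteq> Zero" using Pm by (auto simp: P_def e_def)
    have "c = Pos \<or> c = Neg" using c0 by (cases c) auto
    then have "sign_int ((Xs ! i) e) = sign_int ((Xs ! i1) e)"
    proof
      assume cP: "c = Pos"
      \<comment> \<open>An edge from \<open>e = 0\<close> to \<open>e = +\<close> would have
        \<open>Z j f = - c = Neg\<close>, so the sign of \<open>e\<close> never increases.\<close>
      have "sign_int (- (Xs ! j) e) \<le> sign_int (- (Xs ! s j) e)" if j: "j < n" for j
      proof (cases "(Xs ! j) e = Zero \<and> (Xs ! s j) e \<noteq> Zero")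
        case True
        have "Z j f = - (Xs ! j) f"
          using lex_edge.ascending_edge[OF le[OF j], of f] True c[OF j] c0 fp by blast
        then show ?thesis using Zf[OF j] c[OF j] cP by simp
      next
        case False
        then show ?thesis using Xe[OF j] Xe[OF sn[OF j]]
          by (cases "(Xs ! j) e = Zero"; cases "(Xs ! s j) e = Zero") simp_all
      qed
      then have "sign_int (- (Xs ! i) e) = sign_int (- (Xs ! i1) e)"
        using cyclic_mono_constant[of n "\<lambda>i. sign_int (- (Xs ! i) e)", OF _ i i1(1)] by (simp add: s_def)
      then have "- (Xs ! i) e = - (Xs ! i1) e" by (rule sign_int_inject)
      then show ?thesis by (metis sign_neg_neg)
    next
      assume cN: "c = Neg"
      \<comment> \<open>An edge from \<open>e = +\<close> to \<open>e = 0\<close> would have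
        \<open>Z j f = c = Neg\<close>, so the sign of \<open>e\<close> never decreases.\<close>
      have "sign_int ((Xs ! j) e) \<le> sign_int ((Xs ! s j) e)" if j: "j < n" for j
      proof (cases "(Xs ! j) e \<noteq> Zero \<and> (Xs ! s j) e = Zero")
        case True
        have "Z j f = (Xs ! s j) f"
          using lex_edge.descending_edge[OF le[OF j], of f] True c[OF sn[OF j]] c0 fp by blast
        then show ?thesis using Zf[OF j] c[OF sn[OF j]] cN by simp
      next
        case False
        then show ?thesis using Xe[OF j] Xe[OF sn[OF j]]
          by (cases "(Xs ! j) e = Zero"; cases "(Xs ! s j) e = Zero") simp_all
      qed
      then show ?thesis
        using cyclic_mono_constant[of n "\<lambda>i. sign_int ((Xs ! i) e)", OF _ i i1(1)] by (simp add: s_def)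
    qed
    then have "(Xs ! i) e = (Xs ! i1) e" by (rule sign_int_inject)
    then show ?thesis using Xe[OF i1] by simp
  qed

  define Ys where "Ys = map (\<lambda>X. X(p := Zero)) Xs"
  have Ysn: "length Ys = n" by (simp add: Ys_def n_def)
  have Ysi: "Ys ! i = (Xs ! i)(p := Zero)" if "i < n" for i using that by (simp add: Ys_def n_def)
  \<comment> \<open>All vertices are positive at \<open>p\<close>, so forgetting that value keeps
    them distinct.\<close>
  have "inj_on (\<lambda>X. X(p := Zero)) (set Xs)"
  proof (rule inj_onI)
    fix X Y :: "'a sign_vector"
    assume XY: "X \<in> set Xs" "Y \<in> set Xs" "X(p := Zero) = Y(p := Zero)"
    have "X p = Y p"
      using subsetD[OF vert XY(1)] subsetD[OF vert XY(2)] by (simp add: program_vertices_def)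
    then have "X x = Y x" for x using fun_cong[OF XY(3), of x] by (cases "x = p") simp_all
    then show "X = Y" by blast
  qed
  then have Ysd: "distinct Ys" using dist by (simp add: Ys_def distinct_map)

  \<comment> \<open>The clauses are bundled so that one choice of \<open>W i\<close> per edge
    satisfies all of them.\<close>
  define R where "R i W \<longleftrightarrow> elimination M (- (Ys ! i)) (Ys ! s i) e W \<and> (\<forall>a\<in>A. W a = Zero) \<and>
    (W f \<noteq> Zero \<or> ?\<sigma> W = Zero \<longrightarrow> Z i f = W f) \<and>
    (W f = Zero \<and> ?\<sigma> W \<noteq> Zero \<longrightarrow> Z i f = (if ?\<sigma> W = Pos then - c else c)) \<and>
    (general_position M f \<and> f \<noteq> e \<longrightarrow> W f \<noteq> Zero)" for i W
  have "\<exists>W. R i W" if i: "i < n" for i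
  proof -
    have "lex_edge M M' p es (Xs ! i) (Xs ! s i) m e (Z i)" using le[OF i] all_pos[OF i] by simp
    from lex_edge.level_edge[OF this all_pos[OF i] all_pos[OF sn[OF i]] fp f]
    show ?thesis unfolding R_def Ysi[OF i] Ysi[OF sn[OF i]] c[OF i] A_def using c0 by simp
  qed
  then obtain W where R: "\<And>i. i < n \<Longrightarrow> R i (W i)" by metis
  have Wel: "elimination M (- (Ys ! i)) (Ys ! s i) e (W i)"
    and WA: "\<forall>a\<in>A. W i a = Zero"
    and W1: "W i f \<noteq> Zero \<or> ?\<sigma> (W i) = Zero \<Longrightarrow> Z i f = W i f"
    and W2: "W i f = Zero \<Longrightarrow> ?\<sigma> (W i) \<noteq> Zero \<Longrightarrow> Z i f = (if ?\<sigma> (W i) = Pos then - c else c)"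
    and W3: "general_position M f \<Longrightarrow> f \<noteq> e \<Longrightarrow> W i f \<noteq> Zero" if "i < n" for i
    using R[OF that] unfolding R_def by blast+

  let ?N = "contract M A"
  have Asub: "A \<subseteq> set es" by (simp add: A_def set_take_subset)
  have Aind: "independent M A" by (rule independent_subset[OF M ind Asub])
  have AM: "A \<subseteq> ground M" using Asub esM by blast
  have Nel: "elimination ?N (- (Ys ! i)) (Ys ! s i) e (W i)" if "i < n" for i
    using Wel[OF that] cocircuit_contract[OF _ WA[OF that]] by (simp add: elimination_def)
  have YA: "\<forall>a\<in>A. (Ys ! i) a = Zero" if "i < n" for i using XA[OF that] Ysi[OF that] by simp
  have Nvert: "Ys ! i \<in> program_vertices ?N e" if i: "i < n" for i
  proof -
    have "Ys ! i \<in> cocircuits M" using extension_edge.restrict_X(1)[OF ee[OF i]] Ysi[OF i] by simp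
    moreover have "(Ys ! i) e = Pos" using all_pos[OF i] Ysi[OF i] esp[OF m] by (simp add: e_def)
    ultimately show ?thesis using cocircuit_contract[OF _ YA[OF i]] by (simp add: program_vertices_def)
  qed
  have Nedge: "program_edge ?N e (Ys ! i) (Ys ! s i)" if i: "i < n" for i
  proof -
    have "comodular M (Ys ! i) (Ys ! s i)" "conformal (Ys ! i) (Ys ! s i)"
      using extension_edge.restrict_comodular[OF ee[OF i]] extension_edge.restrict_conformal[OF ee[OF i]]
      by (simp_all add: Ysi[OF i] Ysi[OF sn[OF i]])
    then show ?thesis
      using comodular_contract[OF M Aind _ YA[OF i] YA[OF sn[OF i]]] Nvert[OF i] Nvert[OF sn[OF i]]
      by (simp add: program_edge_def)
  qed
  have cycle_zero: "W i q = Zero"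
    if "euclidean_program ?N e q" "\<And>i. i < n \<Longrightarrow> W i q \<noteq> Neg" "i < n" for q i
    by (rule euclidean_cycle_zero[OF that(1) Ysd])
      (use Nedge Nel that(2,3) in \<open>simp_all add: Ysn s_def\<close>)
  have cycle_zero_rev: "W i q = Zero"
    if "euclidean_program ?N e q" "\<And>i. i < n \<Longrightarrow> W i q \<noteq> Pos" "i < n" for q i
    by (rule euclidean_cycle_zero_reverse[OF that(1) Ysd])
      (use Nedge Nel that(2,3) in \<open>simp_all add: Ysn s_def\<close>)

  have covX: "Ys ! i \<in> covectors M" if "i < n" for i
    using extension_edge.restrict_X(1)[OF ee[OF that]] Ysi[OF that] by (simp add: cocircuits_def)
  have fA: "f \<notin> cl M A"
    by (rule not_in_clI[OF M AM covX[OF i0(1)] YA[OF i0(1)]])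
      (use c[OF i0(1)] c0 Ysi[OF i0(1)] fp in simp)
  \<comment> \<open>Either \<open>f\<close> depends on \<open>A\<close> and \<open>e\<close>, where
    \<open>W i\<close> vanishes, or the program with objective \<open>f\<close> is Euclidean and no
    \<open>W j f\<close> is \<open>Neg\<close>, as a nonzero value equals
    \<open>Z j f\<close>.\<close>
  have Wf: "W i f = Zero" if i: "i < n" for i
  proof (cases "f \<in> cl M (set (take (Suc m) es))")
    case True
    have "set (take (Suc m) es) = insert e A" using m by (simp add: take_Suc_conv_app_nth e_def A_def)
    moreover have "insert e A \<subseteq> ground M" using AM subsetD[OF esM nth_mem[OF m]] by (simp add: e_def)
    moreover have "W i \<in> covectors M" "W i e = Zero"
      using Wel[OF i] by (simp_all add: elimination_def cocircuits_def)
    ultimately show ?thesis using in_clD[OF M, of "insert e A" f "W i"] True WA[OF i] by simp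
  next
    case False
    then have "euclidean_program ?N e f" using objective[OF m] fA by (simp add: A_def e_def)
    moreover have "W j f \<noteq> Neg" if j: "j < n" for j using W1[OF j] Zf[OF j] by auto
    ultimately show ?thesis using cycle_zero i by blast
  qed
  \<comment> \<open>For \<open>f\<close> in general position, \<open>W3\<close> and
    \<open>Wf\<close> leave only \<open>f = e\<close>, which is listed; so \<open>tie\<close>
    applies.\<close>
  have "\<not> general_position M f \<or> f \<in> set es"
    using W3[OF i0(1)] Wf[OF i0(1)] nth_mem[OF m] unfolding e_def by metis
  then have euc: "euclidean_program ?N e (es ! j)" if "m < j" "j < length es" for j
    using tie[OF that] fA by (simp add: A_def e_def)

  \<comment> \<open>Strong induction on the list position for all edges at once: when the earlier
    entries vanish, the localization of \<open>W i\<close> is its entry at \<open>es ! j\<close> if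
    that is nonzero.\<close>
  have Wes: "W i (es ! j) = Zero" if "j < length es" "i < n" for i j
    using that
  proof (induction j arbitrary: i rule: less_induct)
    case (less j)
    consider "j < m" | "j = m" | "m < j" by linarith
    then show ?case
    proof cases
      case 1
      then have "es ! j \<in> A" using nth_mem[of j "take m es"] m by (simp add: A_def)
      then show ?thesis using WA[OF less.prems(2)] by blast
    next
      case 2
      then show ?thesis using Wel[OF less.prems(2)] by (simp add: e_def elimination_def)
    next
      case 3
      have loc: "?\<sigma> (W i) = W i (es ! j)" if i: "i < n" "W i (es ! j) \<noteq> Zero" for i
      proof (rule lex_localization_first[OF less.prems(1)])
        show "W i (es ! j) \<noteq> Zero" by (rule i(2))
        show "\<forall>a\<in>set (take j es). W i a = Zero"
          using less.IH less.prems(1) i(1) by (auto simp: in_set_conv_nth)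
      qed
      \<comment> \<open>By \<open>W2\<close> a nonzero entry of sign \<open>c\<close> would give
        \<open>Z i f = Neg\<close>. So all nonzero entries have sign \<open>- c\<close>, and one of
        the two cycle lemmas applies.\<close>
      have sgn: "W i (es ! j) = (if c = Pos then Neg else Pos)" if i: "i < n" "W i (es ! j) \<noteq> Zero" for i
      proof -
        have "Z i f = (if W i (es ! j) = Pos then - c else c)" using W2[OF i(1) Wf[OF i(1)]] loc[OF i] i(2) by simp
        then show ?thesis using Zf[OF i(1)] i(2) c0 by (cases c; cases "W i (es ! j)") auto
      qed
      show ?thesis
      proof (cases "c = Pos")
        case True
        have "W i (es ! j) \<noteq> Pos" if "i < n" for i using sgn[OF that] True by auto
        then show ?thesis using cycle_zero_rev[OF euc[OF 3 less.prems(1)]] less.prems(2) by blast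
      next
        case False
        have "W i (es ! j) \<noteq> Neg" if "i < n" for i using sgn[OF that] False by auto
        then show ?thesis using cycle_zero[OF euc[OF 3 less.prems(1)]] less.prems(2) by blast
      qed
    qed
  qed
  have "\<forall>a\<in>set es. W i\<^sub>0 a = Zero" using Wes i0(1) by (auto simp: in_set_conv_nth)
  then have "?\<sigma> (W i\<^sub>0) = Zero" by (rule lex_localization_zero)
  then have "Z i\<^sub>0 f = Zero" using W1[OF i0(1)] Wf[OF i0(1)] by simp
  then show False using i0(2) by simp
qed

theorem theorem3p14:
  fixes M M' :: "'a om" and es :: "'a list" and f p :: 'a and k l r :: nat
  assumes "oriented_matroid M" and "r = om_rank M" and "f \<in> ground M"
    and "k = length es" and "1 \<le> k" and "k \<le> r" and "distinct es" and "independent M (set es)"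
    and "l = (if \<exists>j. 1 \<le> j \<and> j \<le> k \<and> f \<in> cl M (set (take j es))
              then LEAST j. 1 \<le> j \<and> j \<le> k \<and> f \<in> cl M (set (take j es))
              else k + 1)"
    and "\<forall>i. 1 \<le> i \<and> i \<le> l - 1 \<longrightarrow>
           euclidean_program (contract M (set (take (i - 1) es))) (es ! (i - 1)) f"
    and "\<not> general_position M f \<or> f \<in> set es \<longrightarrow>
           (\<forall>i j. 1 \<le> i \<and> i \<le> min l (k - 1) \<and> i < j \<and> j \<le> k \<longrightarrow>
              euclidean_program (contract M (set (take (i - 1) es))) (es ! (i - 1)) (es ! (j - 1)))"
    and "lexicographic_extension M es p M'"
  shows "euclidean_program M' p f"
proof -
  note M = assms(1) and ind = assms(8)
  let ?P = "\<lambda>j. 1 \<le> j \<and> j \<le> k \<and> f \<in> cl M (set (take j es))"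
  have l: "1 \<le> l" "l \<le> k \<Longrightarrow> f \<in> cl M (set (take l es))"
  proof -
    have "1 \<le> l \<and> (l \<le> k \<longrightarrow> f \<in> cl M (set (take l es)))"
    proof (cases "\<exists>j. ?P j")
      case True
      then have "l = (LEAST j. ?P j)" using assms(9) by (simp only: if_True)
      then show ?thesis using LeastI_ex[OF True] by simp
    next
      case False
      then have "l = k + 1" using assms(9) by (simp only: if_False)
      then show ?thesis by simp
    qed
    then show "1 \<le> l" "l \<le> k \<Longrightarrow> f \<in> cl M (set (take l es))" by blast+
  qed
  have esM: "set es \<subseteq> ground M" using ind by (simp add: independent_def)
  \<comment> \<open>Closures of initial segments grow, so \<open>f\<close> stays in them from index
    \<open>l\<close> on.\<close>
  have ml: "m < l" if "m < k" "f \<notin> cl M (set (take m es))" for m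
  proof (rule ccontr)
    assume "\<not> m < l"
    then have "l \<le> m" by simp
    then have "cl M (set (take l es)) \<subseteq> cl M (set (take m es))"
      using esM set_take_subset[of m es] by (intro cl_mono[OF M] set_take_subset_set_take) auto
    then show False using l(2) \<open>l \<le> m\<close> that by auto
  qed
  have "om_program M' p f"
  proof (rule lexicographic_extension_program[OF M assms(12) _ ind assms(3)])
    show "es \<noteq> []" using assms(4,5) by auto
    assume col: "coloop M f"
    show "f \<in> cl M {es ! 0}"
    \<comment> \<open>If \<open>l\<close> is not 1, (i) includes the program with \<open>e_1\<close>
      and \<open>f\<close>, so \<open>f\<close> is not a coloop.\<close>
    proof (cases "l = 1")
      case True
      have "take 1 es = [es ! 0]" using assms(4,5) by (cases es) auto
      then show ?thesis using l(2) True assms(5) by simp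
    next
      case False
      then have "euclidean_program M (es ! 0) f" using assms(10)[rule_format, of 1] l(1) by (simp add: contract_empty)
      then show ?thesis using col by (simp add: euclidean_program_def om_program_def)
    qed
  qed
  moreover have "\<not> directed_cycle M' p f Xs" for Xs
  proof (rule lexicographic_extension_acyclic[OF M assms(3) ind assms(12)])
    fix m assume m: "m < length es" "f \<notin> cl M (set (take m es))"
    then have "m < l" using ml assms(4) by simp
    then consider "Suc m = l" | "Suc m \<le> l - 1" by linarith
    then show "f \<in> cl M (set (take (Suc m) es)) \<or> euclidean_program (contract M (set (take m es))) (es ! m) f"
    proof cases
      case 1 then show ?thesis using l(2) m(1) assms(4) by auto
    next
      case 2 then show ?thesis using assms(10)[rule_format, of "Suc m"] by simp
    qed
  next
    fix m j assume mj: "m < j" "j < length es" "f \<notin> cl M (set (take m es))"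
      and "\<not> general_position M f \<or> f \<in> set es"
    moreover have "m < l" using ml mj assms(4) by simp
    \<comment> \<open>With \<open>i = m + 1\<close>, \<open>m < l\<close> gives
      \<open>i \<le> l\<close> and \<open>m < j < k\<close> gives \<open>i \<le> k - 1\<close>, the
      range in (ii).\<close>
    ultimately show "euclidean_program (contract M (set (take m es))) (es ! m) (es ! j)"
      using assms(11)[rule_format, of "Suc m" "Suc j"] assms(4) by simp
  qed
  ultimately show ?thesis by (simp add: euclidean_program_def)
qed

end
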